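(* Let $d\ge2$, let $\omega\subset\mathbb R^{d-1}$ be a bounded Lipschitz set, and let $\Omega_\varepsilon=\omega\times(0,\varepsilon)$. Let $\varepsilon\to0$ along a sequence of positive numbers, let $s_\varepsilon\in(0,\frac12)$ with $s_\varepsilon\to s_0\in[0,\frac12)$, and let $u_\varepsilon\in H^{s_\varepsilon}(\Omega_\varepsilon)$ be such that $$\sup_\varepsilon\frac1{\varepsilon^2}\lfloor u_\varepsilon\rfloor_{s_\varepsilon}^2(\Omega_\varepsilon)<+\infty.$$ Then there exist $u\in L^2(\omega)$, constants $c_\varepsilon\in\mathbb R$, and a subsequence (not relabeled) such that $u_\varepsilon+c_\varepsilon\to u$ in the sense of weak dimension-reduction convergence.
   Context: "Bounded Lipschitz set" means a bounded open set with Lipschitz boundary. Points of $\mathbb R^d$ are written $x=(x',x_d)$ with $x'\in\mathbb R^{d-1}$. For measurable $A\subset\mathbb R^d$ and $s\in(0,1)$, $\lfloor u\rfloor_s^2(A)=\int_A\int_A\frac{|u(x)-u(y)|^2}{|x-y|^{d+2s}}\,dx\,dy$. Weak dimension-reduction convergence: for functions $w_\varepsilon\in H^{s_\varepsilon}(\Omega_\varepsilon)$ and $u\in L^2(\omega)$, one says $w_\varepsilon\to u$ if the functions $v_\varepsilon(x',x_d)=w_\varepsilon(x',\varepsilon x_d)$ on $\omega\times(0,1)$ converge weakly in $L^2(\omega\times(0,1))$ to $v$, where $v(x',x_d)=u(x')$. *)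

theory Defs
  imports "HOL-Analysis.Analysis"
begin

text \<open>
  Lipschitz boundary: near each boundary point, after a rotation, the set is the strict
  epigraph of a Lipschitz function of the remaining coordinates. Here the direction of the
  last rotated coordinate is the unit vector \<open>e\<close>, and the remaining coordinates of \<open>x\<close> are
  encoded by its orthogonal projection \<open>x - (x \<bullet> e) *\<^sub>R e\<close> onto the hyperplane orthogonal to \<open>e\<close>.
  In dimension one that hyperplane is \<open>{0}\<close>, so \<open>g\<close> is a constant.
\<close>

definition lipschitz_boundary :: "'a::euclidean_space set \<Rightarrow> bool" where
  "lipschitz_boundary S \<longleftrightarrow>
    (\<forall>p\<in>frontier S. \<exists>r>0. \<exists>e. norm e = 1 \<and>
      (\<exists>(g::'a \<Rightarrow> real) L. L-lipschitz_on {y. y \<bullet> e = 0} g \<and>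
        S \<inter> ball p r = {x \<in> ball p r. x \<bullet> e > g (x - (x \<bullet> e) *\<^sub>R e)}))"

definition bounded_lipschitz_set :: "'a::euclidean_space set \<Rightarrow> bool" where
  "bounded_lipschitz_set S \<longleftrightarrow> bounded S \<and> open S \<and> lipschitz_boundary S"

text \<open>Functions are total on the ambient space; only their values on the set \<open>A\<close> matter.\<close>

definition L2_on :: "'a::euclidean_space set \<Rightarrow> ('a \<Rightarrow> real) set" where
  "L2_on A = {u. u \<in> borel_measurable (lebesgue_on A) \<and>
                 integrable (lebesgue_on A) (\<lambda>x. (u x)\<^sup>2)}"

text \<open>
  The integrand is \<open>0 / 0 = 0\<close> on the diagonal. The value lies in \<open>[0, \<infinity>]\<close>.
\<close>

definition gagliardo_sq :: "real \<Rightarrow> 'a::euclidean_space set \<Rightarrow> ('a \<Rightarrow> real) \<Rightarrow> ennreal" where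
  "gagliardo_sq s A u =
    (\<integral>\<^sup>+ x. (\<integral>\<^sup>+ y. ennreal (\<bar>u x - u y\<bar>\<^sup>2 / norm (x - y) powr (real DIM('a) + 2 * s))
       \<partial>lebesgue_on A) \<partial>lebesgue_on A)"

definition frac_sobolev :: "real \<Rightarrow> 'a::euclidean_space set \<Rightarrow> ('a \<Rightarrow> real) set" where
  "frac_sobolev s A = {u \<in> L2_on A. gagliardo_sq s A u < \<infinity>}"

definition weakly_converges_L2 ::
    "'a::euclidean_space set \<Rightarrow> (nat \<Rightarrow> 'a \<Rightarrow> real) \<Rightarrow> ('a \<Rightarrow> real) \<Rightarrow> bool" where
  "weakly_converges_L2 A v v0 \<longleftrightarrow>
    (\<forall>k. v k \<in> L2_on A) \<and> v0 \<in> L2_on A \<and>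
    (\<forall>\<phi>\<in>L2_on A. (\<lambda>k. \<integral>x. v k x * \<phi> x \<partial>lebesgue_on A)
        \<longlonglongrightarrow> (\<integral>x. v0 x * \<phi> x \<partial>lebesgue_on A))"

text \<open>
  A point \<open>x = (x', x\<^sub>d)\<close> of \<open>\<real>\<^sup>d\<close> is a pair in \<open>(real^'n) \<times> real\<close> with \<open>CARD('n) = d - 1\<close>; the
  product norm is the Euclidean one, and the product has dimension \<open>d\<close>. Index types are
  nonempty, so \<open>d \<ge> 2\<close> holds automatically.
\<close>

definition thin_domain :: "(real^'n) set \<Rightarrow> real \<Rightarrow> ((real^'n) \<times> real) set" where
  "thin_domain \<omega> \<epsilon> = \<omega> \<times> {0<..<\<epsilon>}"

definition weak_dimred_converges ::
    "(real^'n) set \<Rightarrow> (nat \<Rightarrow> real) \<Rightarrow> (nat \<Rightarrow> (real^'n) \<times> real \<Rightarrow> real) \<Rightarrow> (real^'n \<Rightarrow> real) \<Rightarrow> bool" where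
  "weak_dimred_converges \<omega> \<epsilon> w u \<longleftrightarrow>
    weakly_converges_L2 (\<omega> \<times> {0<..<1})
      (\<lambda>k (x', xd). w k (x', \<epsilon> k * xd)) (\<lambda>(x', xd). u x')"

end

theory Submission
  imports Defs "HOL-Library.Diagonal_Subsequence"
begin

text \<open>
  Rescale \<open>w\<^sub>\<epsilon>(x', t) = u\<^sub>\<epsilon>(x', \<epsilon> t)\<close> on \<open>A = \<omega> \<times> (0, 1)\<close>; the factor \<open>1 / \<epsilon>\<^sup>2\<close> is exactly the
  Jacobian of the double integral. Since the rescaled kernel is bounded below on the bounded set \<open>A\<close>,
  the integral of \<open>\<bar>w\<^sub>\<epsilon>(x) - w\<^sub>\<epsilon>(y)\<bar>\<^sup>2\<close> over \<open>A \<times> A\<close> is bounded, so subtracting a suitable value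
  \<open>w\<^sub>\<epsilon>(y)\<close> gives a sequence that is bounded, hence weakly sequentially compact, in \<open>L\<^sup>2(A)\<close>.

  The limit does not depend on \<open>t\<close>: on pairs with \<open>\<bar>x' - y'\<bar> < \<epsilon>\<close> the kernel is at least
  \<open>(2 \<epsilon>)\<^sup>-\<^sup>d\<close>, whereas the \<open>\<epsilon>\<close>-ball in the \<open>d - 1\<close> horizontal variables has volume of order
  \<open>\<epsilon>\<^sup>d\<^sup>-\<^sup>1\<close>. A test function \<open>h\<close> with vanishing vertical means sees only \<open>w\<^sub>\<epsilon>(x) - w\<^sub>\<epsilon>(y)\<close> with
  \<open>y\<close> averaged over that ball times \<open>(0, 1)\<close>, hence its integral against \<open>w\<^sub>\<epsilon>\<close> is \<open>O(\<surd>\<epsilon>)\<close> as soon as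
  \<open>h\<close> vanishes near the lateral boundary.
\<close>

section \<open>Weak sequential compactness in \<open>L\<^sup>2\<close>\<close>

text \<open>Members are functions rather than classes modulo null sets. The measure is arbitrary
  because the Hilbert space arguments are purely abstract; they are applied to
  \<open>lborel\<close>, whereas \<open>L2_on\<close> refers to the completed measure on a
  subset.\<close>

definition square_integrable :: "'a measure \<Rightarrow> ('a \<Rightarrow> real) set" where
  "square_integrable M = {f \<in> borel_measurable M. integrable M (\<lambda>x. (f x)\<^sup>2)}"

lemma square_integrable_measurable [measurable_dest]:
  "f \<in> square_integrable M \<Longrightarrow> f \<in> borel_measurable M"
  and square_integrable_integrable_square:
  "f \<in> square_integrable M \<Longrightarrow> integrable M (\<lambda>x. (f x)\<^sup>2)"
  by (simp_all add: square_integrable_def)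

lemma square_integrable_integrable_mult:
  assumes f: "f \<in> square_integrable M" and g: "g \<in> square_integrable M"
  shows "integrable M (\<lambda>x. f x * g x)"
proof (rule Bochner_Integration.integrable_bound)
  show "integrable M (\<lambda>x. (f x)\<^sup>2 + (g x)\<^sup>2)"
    using f g by (auto simp: square_integrable_def)
  show "(\<lambda>x. f x * g x) \<in> borel_measurable M"
    using f g by measurable
  show "AE x in M. norm (f x * g x) \<le> norm ((f x)\<^sup>2 + (g x)\<^sup>2)"
  proof (rule AE_I2)
    fix x
    have "2 * (\<bar>f x\<bar> * \<bar>g x\<bar>) \<le> (f x)\<^sup>2 + (g x)\<^sup>2"
      using sum_squares_bound[of "\<bar>f x\<bar>" "\<bar>g x\<bar>"] by (simp add: mult.assoc)
    moreover have "0 \<le> \<bar>f x\<bar> * \<bar>g x\<bar>" by simp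
    ultimately have "\<bar>f x\<bar> * \<bar>g x\<bar> \<le> (f x)\<^sup>2 + (g x)\<^sup>2" by linarith
    then show "norm (f x * g x) \<le> norm ((f x)\<^sup>2 + (g x)\<^sup>2)"
      by (simp add: abs_mult)
  qed
qed

lemma square_integrable_cmult:
  "f \<in> square_integrable M \<Longrightarrow> (\<lambda>x. a * f x) \<in> square_integrable M"
  by (auto simp: square_integrable_def power_mult_distrib)

lemma square_integrable_add:
  assumes f: "f \<in> square_integrable M" and g: "g \<in> square_integrable M"
  shows "(\<lambda>x. f x + g x) \<in> square_integrable M"
proof -
  have "integrable M (\<lambda>x. (f x)\<^sup>2 + (g x)\<^sup>2 + 2 * (f x * g x))"
    using f g square_integrable_integrable_mult[OF f g] by (auto simp: square_integrable_def)
  then show ?thesis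
    using f g by (auto simp: square_integrable_def power2_sum mult.assoc)
qed

lemma square_integrable_diff:
  assumes f: "f \<in> square_integrable M" and g: "g \<in> square_integrable M"
  shows "(\<lambda>x. f x - g x) \<in> square_integrable M"
  using square_integrable_add[OF f square_integrable_cmult[OF g, of "-1"]] by simp

lemma integral_square_add_cmult:
  assumes f: "f \<in> square_integrable M" and g: "g \<in> square_integrable M"
  shows "(\<integral>x. (f x + t * g x)\<^sup>2 \<partial>M)
    = (\<integral>x. (f x)\<^sup>2 \<partial>M) + 2 * t * (\<integral>x. f x * g x \<partial>M) + t\<^sup>2 * (\<integral>x. (g x)\<^sup>2 \<partial>M)"
proof -
  have "(\<lambda>x. (f x + t * g x)\<^sup>2) = (\<lambda>x. (f x)\<^sup>2 + 2 * t * (f x * g x) + t\<^sup>2 * (g x)\<^sup>2)"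
    by (simp add: fun_eq_iff power2_eq_square algebra_simps)
  then show ?thesis
    using square_integrable_integrable_square[OF f] square_integrable_integrable_square[OF g]
      square_integrable_integrable_mult[OF f g]
    by simp
qed

text \<open>Nonpositive discriminant of a quadratic polynomial in \<open>t\<close> without negative
  values. It yields Cauchy-Schwarz, and also the error bound for near minimizers in
  \<open>approximate_Riesz\<close>.\<close>

lemma abs_le_of_quadratic_nonneg:
  fixes N b \<eta> :: real
  assumes "0 \<le> \<eta>" "0 \<le> N" and q: "\<And>t. t\<^sup>2 * N + 2 * t * b + \<eta>\<^sup>2 \<ge> 0"
  shows "\<bar>b\<bar> \<le> \<eta> * sqrt N"
proof (cases "N = 0")
  case True
  have "b = 0"
  proof (rule ccontr)
    assume "b \<noteq> 0"
    \<comment> \<open>The polynomial is now linear in \<open>t\<close>; this root-like value of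
      \<open>t\<close> makes the linear term equal to -2 (\<eta>^2 + 1), which is too
      negative.\<close>
    then have "(- (\<eta>\<^sup>2 + 1) / b) * b = - (\<eta>\<^sup>2 + 1)" by simp
    with q[of "- (\<eta>\<^sup>2 + 1) / b"] True \<open>b \<noteq> 0\<close> have "2 \<le> - (\<eta>\<^sup>2)"
      by (simp add: mult.assoc)
    moreover have "- (\<eta>\<^sup>2) \<le> 0" by simp
    ultimately have "(2::real) \<le> 0" by (rule order_trans)
    then show False by simp
  qed
  then show ?thesis using True by simp
next
  case False
  then have N: "N > 0" using assms by simp
  \<comment> \<open>The vertex \<open>t = - b / N\<close> gives the strongest inequality.\<close>
  have "b\<^sup>2 / N \<le> \<eta>\<^sup>2"
    using q[of "- b / N"] N by (simp add: field_simps power2_eq_square)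
  then have "b\<^sup>2 \<le> (\<eta> * sqrt N)\<^sup>2"
    using N by (simp add: field_simps power_mult_distrib)
  then have "\<bar>b\<bar> \<le> \<bar>\<eta> * sqrt N\<bar>"
    by (rule abs_le_square_iff[THEN iffD2])
  then show ?thesis using assms by simp
qed

text \<open>The squared norm of f + t g is a nonnegative quadratic in \<open>t\<close>; its
  discriminant is the claim.\<close>

lemma Cauchy_Schwarz_integral:
  assumes f: "f \<in> square_integrable M" and g: "g \<in> square_integrable M"
  shows "\<bar>\<integral>x. f x * g x \<partial>M\<bar> \<le> sqrt (\<integral>x. (f x)\<^sup>2 \<partial>M) * sqrt (\<integral>x. (g x)\<^sup>2 \<partial>M)"
proof (rule abs_le_of_quadratic_nonneg)
  fix t
  have "0 \<le> (\<integral>x. (f x + t * g x)\<^sup>2 \<partial>M)" by simp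
  then show "0 \<le> t\<^sup>2 * (\<integral>x. (g x)\<^sup>2 \<partial>M) + 2 * t * (\<integral>x. f x * g x \<partial>M) + (sqrt (\<integral>x. (f x)\<^sup>2 \<partial>M))\<^sup>2"
    unfolding integral_square_add_cmult[OF f g] by (simp add: algebra_simps)
qed simp_all

text \<open>
  An almost minimizer of \<open>h \<mapsto> \<parallel>h\<parallel>\<^sup>2 - 2 \<Lambda> h\<close> almost represents \<open>\<Lambda>\<close>, so \<open>S\<close> need not be closed.
  When \<open>\<Lambda>\<close> is the inner product with a fixed function, this is an approximate orthogonal projection.
\<close>

lemma approximate_Riesz:
  assumes S: "S \<subseteq> square_integrable M" "S \<noteq> {}"
    and add: "\<And>f g t. f \<in> S \<Longrightarrow> g \<in> S \<Longrightarrow> (\<lambda>x. f x + t * g x) \<in> S"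
    and lin: "\<And>f g t. f \<in> S \<Longrightarrow> g \<in> S \<Longrightarrow> \<Lambda> (\<lambda>x. f x + t * g x) = \<Lambda> f + t * \<Lambda> g"
    and bd: "\<And>f. f \<in> S \<Longrightarrow> \<bar>\<Lambda> f\<bar> \<le> C * sqrt (\<integral>x. (f x)\<^sup>2 \<partial>M)"
    and \<eta>: "\<eta> > 0"
  obtains w where "w \<in> S"
    "\<And>h. h \<in> S \<Longrightarrow> \<bar>(\<integral>x. w x * h x \<partial>M) - \<Lambda> h\<bar> \<le> \<eta> * sqrt (\<integral>x. (h x)\<^sup>2 \<partial>M)"
proof -
  define J where "J h = (\<integral>x. (h x)\<^sup>2 \<partial>M) - 2 * \<Lambda> h" for h
  have "- C\<^sup>2 \<le> J h" if "h \<in> S" for h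
  proof -
    \<comment> \<open>\<open>J h\<close> is at least n^2 - 2 C n, and completing the square bounds
      this below by -C^2.\<close>
    define n where "n = sqrt (\<integral>x. (h x)\<^sup>2 \<partial>M)"
    have "J h \<ge> n\<^sup>2 - 2 * (C * n)"
      using bd[OF that] by (auto simp: J_def n_def)
    moreover have "(n - C)\<^sup>2 \<ge> 0" by simp
    ultimately show ?thesis by (simp add: power2_diff algebra_simps)
  qed
  then have bdd: "bdd_below (J ` S)" by (auto intro!: bdd_belowI)
  have "Inf (J ` S) < Inf (J ` S) + \<eta>\<^sup>2" using \<eta> by simp
  then obtain w where w: "w \<in> S" "J w < Inf (J ` S) + \<eta>\<^sup>2"
    using S(2) by (subst (asm) cInf_less_iff[OF _ bdd]) auto
  have "\<bar>(\<integral>x. w x * h x \<partial>M) - \<Lambda> h\<bar> \<le> \<eta> * sqrt (\<integral>x. (h x)\<^sup>2 \<partial>M)" if h: "h \<in> S" for h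
  proof (rule abs_le_of_quadratic_nonneg)
    fix t
    \<comment> \<open>As \<open>J w\<close> is within \<eta>^2 of the infimum, adding
      \<open>t * h\<close> lowers \<open>J\<close> by at most \<eta>^2. Expanding the increment in
      \<open>t\<close> gives the quadratic that has to be nonnegative.\<close>
    have "Inf (J ` S) \<le> J (\<lambda>x. w x + t * h x)"
      using add[OF w(1) h] bdd by (auto intro: cInf_lower)
    then have "J w \<le> J (\<lambda>x. w x + t * h x) + \<eta>\<^sup>2"
      using w by simp
    moreover have "J (\<lambda>x. w x + t * h x)
      = J w + 2 * t * ((\<integral>x. w x * h x \<partial>M) - \<Lambda> h) + t\<^sup>2 * (\<integral>x. (h x)\<^sup>2 \<partial>M)"
      using S w h by (subst J_def, subst integral_square_add_cmult)
        (auto simp: lin J_def algebra_simps)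
    ultimately show "0 \<le> t\<^sup>2 * (\<integral>x. (h x)\<^sup>2 \<partial>M) + 2 * t * ((\<integral>x. w x * h x \<partial>M) - \<Lambda> h) + \<eta>\<^sup>2"
      by simp
  qed (use \<eta> in simp_all)
  with w(1) show thesis by (rule that)
qed

section \<open>Completeness and the Riesz representation\<close>

text \<open>The prescribed geometric rate makes the whole sequence converge almost everywhere,
  without passing to a subsequence. Fatou's lemma then turns the Cauchy estimate into a rate of
  convergence in norm.\<close>

lemma square_integrable_complete:
  assumes h: "\<And>n. h n \<in> square_integrable M"
    and cauchy: "\<And>m n. sqrt (\<integral>x. (h m x - h n x)\<^sup>2 \<partial>M) \<le> (1/2)^m + (1/2)^n"
  obtains g where "g \<in> square_integrable M"
    "\<And>n. sqrt (\<integral>x. (h n x - g x)\<^sup>2 \<partial>M) \<le> 2 * (1/2)^n"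
proof -
  note [measurable] = square_integrable_measurable[OF h]
  have sq: "(\<integral>\<^sup>+x. ennreal ((h m x - h n x)\<^sup>2) \<partial>M) \<le> ennreal (((1/2)^m + (1/2)^n)\<^sup>2)" for m n
  proof -
    have "(\<integral>\<^sup>+x. ennreal ((h m x - h n x)\<^sup>2) \<partial>M) = ennreal (\<integral>x. (h m x - h n x)\<^sup>2 \<partial>M)"
      using square_integrable_diff[OF h h] by (intro nn_integral_eq_integral) (auto simp: square_integrable_def)
    also have "(\<integral>x. (h m x - h n x)\<^sup>2 \<partial>M) = (sqrt (\<integral>x. (h m x - h n x)\<^sup>2 \<partial>M))\<^sup>2" by simp
    also have "ennreal \<dots> \<le> ennreal (((1/2)^m + (1/2)^n)\<^sup>2)"
      using cauchy by (intro ennreal_leI power_mono) auto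
    finally show ?thesis .
  qed
  text \<open>By \<open>\<bar>d\<bar> \<le> 2\<^sup>-\<^sup>n + 2\<^sup>n d\<^sup>2\<close>, finiteness of \<open>\<Sum>n. D n x\<close> makes \<open>h n x\<close> converge.\<close>
  define D where "D n x = 2^n * (h (Suc n) x - h n x)\<^sup>2" for n x
  have [measurable]: "D n \<in> borel_measurable M" for n unfolding D_def by measurable
  have "(\<integral>\<^sup>+x. (\<Sum>n. ennreal (D n x)) \<partial>M) = (\<Sum>n. \<integral>\<^sup>+x. ennreal (D n x) \<partial>M)"
    by (rule nn_integral_suminf) measurable
  \<comment> \<open>The increment has norm at most (3/2) 2^-n, so the weighted square integral is at
    most (9/4) 2^-n; the factor 4 is a rounder bound.\<close>
  also have "\<dots> \<le> (\<Sum>n. ennreal (4 * (1/2)^n))"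
  proof (rule suminf_le)
    fix n
    have "(\<integral>\<^sup>+x. ennreal (D n x) \<partial>M) = ennreal (2^n) * (\<integral>\<^sup>+x. ennreal ((h (Suc n) x - h n x)\<^sup>2) \<partial>M)"
      unfolding D_def by (simp add: ennreal_mult' nn_integral_cmult)
    also have "\<dots> \<le> ennreal (2^n) * ennreal (((1/2)^Suc n + (1/2)^n)\<^sup>2)"
      by (intro mult_left_mono sq) simp
    also have "\<dots> = ennreal (2^n * ((3/2) * (1/2)^n)\<^sup>2)"
      by (simp add: ennreal_mult'[symmetric])
    also have "2^n * ((3/2) * (1/2)^n)\<^sup>2 = (9/4) * (1/2::real)^n"
      using power_mult_distrib[of "2::real" 2 n]
      by (simp add: power2_eq_square power_divide field_simps)
    also have "ennreal \<dots> \<le> ennreal (4 * (1/2)^n)" by (intro ennreal_leI) simp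
    finally show "(\<integral>\<^sup>+x. ennreal (D n x) \<partial>M) \<le> ennreal (4 * (1/2)^n)" .
  qed auto
  also have "\<dots> = ennreal (\<Sum>n. 4 * (1/2)^n)"
    by (rule suminf_ennreal2) (auto intro!: summable_mult summable_geometric)
  finally have "(\<integral>\<^sup>+x. (\<Sum>n. ennreal (D n x)) \<partial>M) < \<infinity>"
    using ennreal_less_top le_less_trans by fastforce
  then have "AE x in M. (\<Sum>n. ennreal (D n x)) \<noteq> \<infinity>"
    by (intro nn_integral_PInf_AE) auto
  then have conv: "AE x in M. (\<lambda>n. h n x) \<longlonglongrightarrow> lim (\<lambda>n. h n x)"
  proof eventually_elim
    case (elim x)
    have "summable (\<lambda>n. D n x)"
      using elim by (intro summable_suminf_not_top) (auto simp: D_def)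
    moreover have "summable (\<lambda>n. (1/2::real)^n)" by (simp add: summable_geometric)
    ultimately have *: "summable (\<lambda>n. (1/2)^n + D n x)" by (rule summable_add[rotated])
    have "summable (\<lambda>n. h (Suc n) x - h n x)"
    proof (rule summable_comparison_test'[OF *])
      fix n :: nat
      define d where "d = \<bar>h (Suc n) x - h n x\<bar>"
      have "(2::real)^n * (1/2)^n = 1" by (simp add: power_divide)
      then have "(1/2::real)^n * (1 - 2^n * d)\<^sup>2 = (1/2)^n + 2^n * d\<^sup>2 - 2 * d"
        by (simp add: power2_eq_square algebra_simps)
      moreover have "(1/2::real)^n * (1 - 2^n * d)\<^sup>2 \<ge> 0" "d \<ge> 0" by (simp_all add: d_def)
      ultimately have "d \<le> (1/2)^n + 2^n * d\<^sup>2" by linarith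
      then show "norm (h (Suc n) x - h n x) \<le> (1/2)^n + D n x"
        by (simp add: d_def D_def)
    qed
    then have "summable (\<lambda>n. h (Suc n) x - h n x)" .
    then have "(\<lambda>n. \<Sum>i<n. h (Suc i) x - h i x) \<longlonglongrightarrow> (\<Sum>i. h (Suc i) x - h i x)"
      by (rule summable_LIMSEQ)
    then have "(\<lambda>n. (h n x - h 0 x) + h 0 x) \<longlonglongrightarrow> (\<Sum>i. h (Suc i) x - h i x) + h 0 x"
      by (intro tendsto_add) (simp_all add: sum_lessThan_telescope[of "\<lambda>n. h n x"])
    then have "convergent (\<lambda>n. h n x)" by (auto simp: convergent_def)
    then show ?case by (simp add: convergent_LIMSEQ_iff)
  qed
  define g where "g x = lim (\<lambda>n. h n x)" for x
  have [measurable]: "g \<in> borel_measurable M" unfolding g_def by measurable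
  \<comment> \<open>Fatou's lemma as \<open>m\<close> tends to infinity in \<open>sq n m\<close>;
    for \<open>m \<ge> n\<close> the Cauchy bound is at most twice the power with exponent
    \<open>n\<close>.\<close>
  have bound: "(\<integral>\<^sup>+x. ennreal ((h n x - g x)\<^sup>2) \<partial>M) \<le> ennreal ((2 * (1/2)^n)\<^sup>2)" for n
  proof -
    have "(\<integral>\<^sup>+x. ennreal ((h n x - g x)\<^sup>2) \<partial>M)
      = (\<integral>\<^sup>+x. liminf (\<lambda>m. ennreal ((h n x - h m x)\<^sup>2)) \<partial>M)"
    proof (rule nn_integral_cong_AE)
      show "AE x in M. ennreal ((h n x - g x)\<^sup>2) = liminf (\<lambda>m. ennreal ((h n x - h m x)\<^sup>2))"
        using conv
      proof eventually_elim
        case (elim x)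
        then have "(\<lambda>m. ennreal ((h n x - h m x)\<^sup>2)) \<longlonglongrightarrow> ennreal ((h n x - g x)\<^sup>2)"
          unfolding g_def by (intro tendsto_intros tendsto_ennrealI)
        then show ?case by (intro lim_imp_Liminf[symmetric]) simp_all
      qed
    qed
    also have "\<dots> \<le> liminf (\<lambda>m. \<integral>\<^sup>+x. ennreal ((h n x - h m x)\<^sup>2) \<partial>M)"
      by (rule nn_integral_liminf) measurable
    also have "\<dots> \<le> liminf (\<lambda>m. ennreal ((2 * (1/2)^n)\<^sup>2))"
    proof (rule Liminf_mono, rule eventually_mono[OF eventually_ge_at_top[of n]])
      fix m assume "m \<ge> n"
      then have "(1/2::real)^m \<le> (1/2)^n" by (intro power_decreasing) auto
      then have "ennreal (((1/2)^n + (1/2)^m)\<^sup>2) \<le> ennreal ((2 * (1/2)^n)\<^sup>2)"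
        by (intro ennreal_leI power_mono) auto
      with sq[of n m] show "(\<integral>\<^sup>+x. ennreal ((h n x - h m x)\<^sup>2) \<partial>M) \<le> ennreal ((2 * (1/2)^n)\<^sup>2)"
        by (rule order_trans)
    qed
    also have "\<dots> = ennreal ((2 * (1/2)^n)\<^sup>2)" by (simp add: Liminf_const)
    finally show ?thesis .
  qed
  have diff: "(\<lambda>x. h n x - g x) \<in> square_integrable M" for n
    using le_less_trans[OF bound[of n] ennreal_less_top]
    by (auto simp: square_integrable_def intro!: integrableI_nonneg)
  \<comment> \<open>\<open>g\<close> is written as \<open>h 0 - (h 0 - g)\<close>, a difference of
    two square integrable functions.\<close>
  have "g \<in> square_integrable M"
    using square_integrable_diff[OF h[of 0] diff[of 0]] by simp
  moreover have "sqrt (\<integral>x. (h n x - g x)\<^sup>2 \<partial>M) \<le> 2 * (1/2)^n" for n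
  proof -
    have "ennreal (\<integral>x. (h n x - g x)\<^sup>2 \<partial>M) \<le> ennreal ((2 * (1/2)^n)\<^sup>2)"
      using bound[of n] diff[of n]
      by (subst nn_integral_eq_integral[symmetric]) (auto simp: square_integrable_def)
    then have "(\<integral>x. (h n x - g x)\<^sup>2 \<partial>M) \<le> (2 * (1/2)^n)\<^sup>2"
      by (subst (asm) ennreal_le_iff) auto
    then show ?thesis by (intro real_le_lsqrt) auto
  qed
  ultimately show thesis by (rule that)
qed

text \<open>Approximate representers with errors 2^-n form a Cauchy sequence, and their limit
  represents \<Lambda> exactly.\<close>

lemma Riesz_representation:
  assumes add: "\<And>f g t. f \<in> square_integrable M \<Longrightarrow> g \<in> square_integrable M \<Longrightarrow>
      \<Lambda> (\<lambda>x. f x + t * g x) = \<Lambda> f + t * \<Lambda> g"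
    and bd: "\<And>f. f \<in> square_integrable M \<Longrightarrow> \<bar>\<Lambda> f\<bar> \<le> C * sqrt (\<integral>x. (f x)\<^sup>2 \<partial>M)"
  obtains u where "u \<in> square_integrable M"
    "\<And>f. f \<in> square_integrable M \<Longrightarrow> \<Lambda> f = (\<integral>x. u x * f x \<partial>M)"
proof -
  let ?S = "square_integrable M"
  have "(\<lambda>x. 0) \<in> ?S" by (simp add: square_integrable_def)
  then have ne: "?S \<noteq> {}" by auto
  have "\<exists>w\<in>?S. \<forall>f\<in>?S. \<bar>(\<integral>x. w x * f x \<partial>M) - \<Lambda> f\<bar> \<le> (1/2)^n * sqrt (\<integral>x. (f x)\<^sup>2 \<partial>M)" for n :: nat
    by (rule approximate_Riesz[OF order_refl ne _ add bd, of "(1/2)^n"])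
      (auto intro: square_integrable_add square_integrable_cmult)
  then obtain w where w: "\<And>n. w n \<in> ?S"
    and wl: "\<And>n f. f \<in> ?S \<Longrightarrow> \<bar>(\<integral>x. w n x * f x \<partial>M) - \<Lambda> f\<bar> \<le> (1/2)^n * sqrt (\<integral>x. (f x)\<^sup>2 \<partial>M)"
    by metis
  have "sqrt (\<integral>x. (w m x - w n x)\<^sup>2 \<partial>M) \<le> (1/2)^m + (1/2)^n" for m n
  proof -
    \<comment> \<open>Both representers are tested against their own difference. Its squared norm is
      then a difference of two numbers close to the same value \<open>\<Lambda> f\<close>.\<close>
    define f where "f x = w m x - w n x" for x
    have f: "f \<in> ?S" unfolding f_def by (intro square_integrable_diff w)
    define N where "N = sqrt (\<integral>x. (f x)\<^sup>2 \<partial>M)"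
    have "N * N = (\<integral>x. f x * f x \<partial>M)"
      by (simp add: N_def power2_eq_square)
    also have "\<dots> = (\<integral>x. w m x * f x - w n x * f x \<partial>M)"
      by (simp add: f_def algebra_simps)
    also have "\<dots> = (\<integral>x. w m x * f x \<partial>M) - (\<integral>x. w n x * f x \<partial>M)"
      by (intro Bochner_Integration.integral_diff square_integrable_integrable_mult w f)
    also have "\<dots> \<le> ((1/2)^m + (1/2)^n) * N"
      using wl[OF f, of m] wl[OF f, of n] by (simp add: N_def algebra_simps)
    finally have "N * N \<le> ((1/2)^m + (1/2)^n) * N" .
    moreover have "0 \<le> N" by (simp add: N_def)
    ultimately have "N \<le> (1/2)^m + (1/2)^n"
      by (cases "N = 0") (auto simp: mult_le_cancel_right)
    then show ?thesis by (simp add: N_def f_def)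
  qed
  then obtain u where u: "u \<in> ?S" and wu: "\<And>n. sqrt (\<integral>x. (w n x - u x)\<^sup>2 \<partial>M) \<le> 2 * (1/2)^n"
    using square_integrable_complete[of w M] w by blast
  have "\<Lambda> f = (\<integral>x. u x * f x \<partial>M)" if f: "f \<in> ?S" for f
  proof -
    define N where "N = sqrt (\<integral>x. (f x)\<^sup>2 \<partial>M)"
    \<comment> \<open>Of the factor 3, one unit is the error of \<open>w n\<close> as a representer
      and two are its distance from \<open>u\<close>.\<close>
    have bound: "\<bar>\<Lambda> f - (\<integral>x. u x * f x \<partial>M)\<bar> \<le> 3 * N * (1/2)^n" for n
    proof -
      have "(\<integral>x. w n x * f x \<partial>M) - (\<integral>x. u x * f x \<partial>M) = (\<integral>x. (w n x - u x) * f x \<partial>M)"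
        using square_integrable_integrable_mult[OF w f] square_integrable_integrable_mult[OF u f]
        by (simp add: algebra_simps)
      also have "\<bar>\<dots>\<bar> \<le> sqrt (\<integral>x. (w n x - u x)\<^sup>2 \<partial>M) * N"
        unfolding N_def by (intro Cauchy_Schwarz_integral square_integrable_diff w u f)
      also have "\<dots> \<le> 2 * (1/2)^n * N"
        by (intro mult_right_mono wu) (simp add: N_def)
      finally show ?thesis
        using wl[OF f, of n] by (simp add: N_def algebra_simps)
    qed
    have "(\<lambda>n. 3 * N * (1/2)^n) \<longlonglongrightarrow> 3 * N * 0"
      by (intro tendsto_mult tendsto_const LIMSEQ_power_zero) simp
    then have "\<bar>\<Lambda> f - (\<integral>x. u x * f x \<partial>M)\<bar> \<le> 3 * N * 0"
      using bound by (intro LIMSEQ_le_const) auto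
    then show ?thesis by simp
  qed
  with u show thesis by (rule that)
qed

section \<open>Extraction of weakly convergent subsequences\<close>

text \<open>Cantor's diagonal argument, with compactness of the interval from \<open>- B j\<close>
  to \<open>B j\<close> at stage \<open>j\<close>.\<close>

lemma diagonal_convergent_subsequence:
  fixes a :: "nat \<Rightarrow> nat \<Rightarrow> real"
  assumes "\<And>k j. \<bar>a k j\<bar> \<le> B j"
  obtains r :: "nat \<Rightarrow> nat" where "strict_mono r" "\<And>j. convergent (\<lambda>k. a (r k) j)"
proof -
  interpret subseqs "\<lambda>j r. convergent (\<lambda>k. a (r k) j)"
  proof
    fix j and s :: "nat \<Rightarrow> nat"
    have "\<forall>k. a (s k) j \<in> {- B j..B j}" using assms by (simp add: abs_le_iff minus_le_iff)
    then obtain l r where "strict_mono r" "((\<lambda>k. a (s k) j) \<circ> r) \<longlonglongrightarrow> l"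
      by (rule seq_compactE[OF compact_imp_seq_compact[OF compact_Icc]])
    then show "\<exists>r. strict_mono r \<and> convergent (\<lambda>k. a ((s \<circ> r) k) j)"
      by (auto simp: comp_def convergent_def)
  qed
  have "convergent (\<lambda>k. a (diagseq k) j)" for j
  proof -
    \<comment> \<open>The diagonal sequence is a subsequence of the sequence of stage
      \<open>j\<close> only from index \<open>Suc j\<close> on, so an initial segment is
      dropped.\<close>
    have "convergent (\<lambda>k. a ((diagseq \<circ> (+) (Suc j)) k) j)"
      by (rule diagseq_holds) (auto simp: comp_def dest: convergent_subseq_convergent)
    then show ?thesis
      using convergent_ignore_initial_segment[of "\<lambda>k. a (diagseq k) j" "Suc j"]
      by (simp add: add.commute)
  qed
  with subseq_diagseq show thesis by (rule that)
qed

text \<open>The countable family of test functions for the diagonal argument is the sequence itself.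
  Convergence extends from there to all test functions, and the resulting bounded linear functional
  has a representer, which is the weak limit.\<close>

lemma weakly_convergent_subsequence:
  fixes f :: "nat \<Rightarrow> 'a \<Rightarrow> real"
  assumes f: "\<And>k. f k \<in> square_integrable M"
    and bd: "\<And>k. (\<integral>x. (f k x)\<^sup>2 \<partial>M) \<le> C"
  obtains r u where "strict_mono r" "u \<in> square_integrable M"
    "\<forall>\<phi>\<in>square_integrable M. (\<lambda>k. \<integral>x. f (r k) x * \<phi> x \<partial>M) \<longlonglongrightarrow> (\<integral>x. u x * \<phi> x \<partial>M)"
proof -
  let ?L = "square_integrable M"
  define K where "K = sqrt C"
  have fK: "sqrt (\<integral>x. (f k x)\<^sup>2 \<partial>M) \<le> K" for k
    using bd by (simp add: K_def)
  have "0 \<le> sqrt (\<integral>x. (f 0 x)\<^sup>2 \<partial>M)" by simp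
  with fK[of 0] have K: "K \<ge> 0" by linarith
  have fb: "\<bar>\<integral>x. f k x * \<phi> x \<partial>M\<bar> \<le> K * sqrt (\<integral>x. (\<phi> x)\<^sup>2 \<partial>M)" if "\<phi> \<in> ?L" for k \<phi>
    using Cauchy_Schwarz_integral[OF f that, of k]
      mult_right_mono[OF fK[of k], of "sqrt (\<integral>x. (\<phi> x)\<^sup>2 \<partial>M)"] by simp
  obtain r :: "nat \<Rightarrow> nat" where r: "strict_mono r"
    and conv: "\<And>j. convergent (\<lambda>k. \<integral>x. f (r k) x * f j x \<partial>M)"
    using diagonal_convergent_subsequence[of "\<lambda>k j. \<integral>x. f k x * f j x \<partial>M", OF fb[OF f]] by metis
  text \<open>
    \<open>S\<close> is a subspace that contains every \<open>f j\<close>. Replacing \<open>\<phi>\<close> by its approximate projection to \<open>S\<close>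
    changes all inner products \<open>\<langle>f j, \<phi>\<rangle>\<close> uniformly little, hence \<open>S\<close> is the whole space.
  \<close>
  define S where "S = {\<phi> \<in> ?L. convergent (\<lambda>k. \<integral>x. f (r k) x * \<phi> x \<partial>M)}"
  have add_int: "(\<integral>x. f (r k) x * (\<phi> x + t * \<psi> x) \<partial>M)
      = (\<integral>x. f (r k) x * \<phi> x \<partial>M) + t * (\<integral>x. f (r k) x * \<psi> x \<partial>M)"
    if "\<phi> \<in> ?L" "\<psi> \<in> ?L" for \<phi> \<psi> t k
    using square_integrable_integrable_mult[OF f that(1), of "r k"]
      square_integrable_integrable_mult[OF f that(2), of "r k"]
    by (simp add: algebra_simps)
  have fS: "f j \<in> S" for j using f conv by (simp add: S_def)
  have Sadd: "(\<lambda>x. \<phi> x + t * \<psi> x) \<in> S" if "\<phi> \<in> S" "\<psi> \<in> S" for \<phi> \<psi> t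
    using that add_int
    by (auto simp: S_def intro!: square_integrable_add square_integrable_cmult convergent_add convergent_mult convergent_const)
  have LS: "\<phi> \<in> S" if \<phi>: "\<phi> \<in> ?L" for \<phi>
  proof -
    have "Cauchy (\<lambda>k. \<integral>x. f (r k) x * \<phi> x \<partial>M)"
    proof (rule metric_CauchyI)
      fix e :: real assume e: "e > 0"
      \<comment> \<open>Two replacements of \<open>\<phi>\<close> by \<open>w\<close> and one Cauchy
        estimate cost a third of \<open>e\<close> each; \<open>K + 1\<close> keeps the denominator
        positive when \<open>K = 0\<close>.\<close>
      define \<eta> where "\<eta> = e / (3 * (K + 1))"
      have \<eta>: "\<eta> > 0" "\<eta> * K < e / 3"
        using e K by (simp_all add: \<eta>_def field_simps)
      obtain w where w: "w \<in> S" and wh: "\<And>h. h \<in> S \<Longrightarrow>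
          \<bar>(\<integral>x. w x * h x \<partial>M) - (\<integral>x. \<phi> x * h x \<partial>M)\<bar> \<le> \<eta> * sqrt (\<integral>x. (h x)\<^sup>2 \<partial>M)"
      proof (rule approximate_Riesz[of S M "\<lambda>h. \<integral>x. \<phi> x * h x \<partial>M"])
        show "S \<subseteq> ?L" "S \<noteq> {}" using fS by (auto simp: S_def)
        show "(\<integral>x. \<phi> x * (h x + t * g x) \<partial>M) = (\<integral>x. \<phi> x * h x \<partial>M) + t * (\<integral>x. \<phi> x * g x \<partial>M)"
          if "h \<in> S" "g \<in> S" for h g t
          using square_integrable_integrable_mult[OF \<phi>, of h]
            square_integrable_integrable_mult[OF \<phi>, of g] that
          by (simp add: algebra_simps S_def)
        show "\<bar>\<integral>x. \<phi> x * h x \<partial>M\<bar> \<le> sqrt (\<integral>x. (\<phi> x)\<^sup>2 \<partial>M) * sqrt (\<integral>x. (h x)\<^sup>2 \<partial>M)" if "h \<in> S" for h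
          using that by (intro Cauchy_Schwarz_integral \<phi>) (simp add: S_def)
      qed (use Sadd \<eta> in auto)
      have near: "\<bar>(\<integral>x. f (r k) x * w x \<partial>M) - (\<integral>x. f (r k) x * \<phi> x \<partial>M)\<bar> < e / 3" for k
      proof -
        have "\<eta> * sqrt (\<integral>x. (f (r k) x)\<^sup>2 \<partial>M) \<le> \<eta> * K"
          using \<eta> fK by (intro mult_left_mono) auto
        then have "\<bar>(\<integral>x. w x * f (r k) x \<partial>M) - (\<integral>x. \<phi> x * f (r k) x \<partial>M)\<bar> < e / 3"
          using wh[OF fS[of "r k"]] \<eta>(2) by linarith
        then show ?thesis by (simp only: mult.commute)
      qed
      have "Cauchy (\<lambda>k. \<integral>x. f (r k) x * w x \<partial>M)"
        using w by (simp add: S_def Cauchy_convergent_iff)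
      then obtain n where n: "\<And>k l. k \<ge> n \<Longrightarrow> l \<ge> n \<Longrightarrow>
          dist (\<integral>x. f (r k) x * w x \<partial>M) (\<integral>x. f (r l) x * w x \<partial>M) < e / 3"
        using e by (meson metric_CauchyD divide_pos_pos zero_less_numeral)
      have "dist (\<integral>x. f (r k) x * \<phi> x \<partial>M) (\<integral>x. f (r l) x * \<phi> x \<partial>M) < e" if "k \<ge> n" "l \<ge> n" for k l
        using near[of k] near[of l] n[OF that] unfolding dist_real_def by linarith
      then show "\<exists>n. \<forall>k\<ge>n. \<forall>l\<ge>n. dist (\<integral>x. f (r k) x * \<phi> x \<partial>M) (\<integral>x. f (r l) x * \<phi> x \<partial>M) < e"
        by blast
    qed
    then show ?thesis using \<phi> by (simp add: S_def Cauchy_convergent_iff)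
  qed
  \<comment> \<open>The limit inherits linearity and the bound \<open>K\<close> from the inner
    products with \<open>f (r k)\<close>.\<close>
  define \<Lambda> where "\<Lambda> \<phi> = lim (\<lambda>k. \<integral>x. f (r k) x * \<phi> x \<partial>M)" for \<phi>
  have lim: "(\<lambda>k. \<integral>x. f (r k) x * \<phi> x \<partial>M) \<longlonglongrightarrow> \<Lambda> \<phi>" if "\<phi> \<in> ?L" for \<phi>
    using LS[OF that] by (simp add: S_def \<Lambda>_def convergent_LIMSEQ_iff)
  show thesis
  proof (rule Riesz_representation[of M \<Lambda> K])
    fix \<phi> \<psi> t assume *: "\<phi> \<in> ?L" "\<psi> \<in> ?L"
    have "(\<lambda>k. \<integral>x. f (r k) x * (\<phi> x + t * \<psi> x) \<partial>M) \<longlonglongrightarrow> \<Lambda> \<phi> + t * \<Lambda> \<psi>"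
      unfolding add_int[OF *] by (intro tendsto_intros lim *)
    with lim[OF square_integrable_add[OF *(1) square_integrable_cmult[OF *(2)]]]
    show "\<Lambda> (\<lambda>x. \<phi> x + t * \<psi> x) = \<Lambda> \<phi> + t * \<Lambda> \<psi>"
      by (rule LIMSEQ_unique)
  next
    fix \<phi> assume "\<phi> \<in> ?L"
    then show "\<bar>\<Lambda> \<phi>\<bar> \<le> K * sqrt (\<integral>x. (\<phi> x)\<^sup>2 \<partial>M)"
      using fb by (intro LIMSEQ_le_const2[OF tendsto_rabs[OF lim]]) auto
  next
    fix u assume "u \<in> ?L" "\<And>\<phi>. \<phi> \<in> ?L \<Longrightarrow> \<Lambda> \<phi> = (\<integral>x. u x * \<phi> x \<partial>M)"
    then show thesis using that[OF r, of u] lim by simp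
  qed
qed

section \<open>Product and completed Lebesgue measure\<close>

lemma nn_integral_lborel_prod:
  fixes f :: "'a::euclidean_space \<times> 'b::euclidean_space \<Rightarrow> ennreal"
  assumes "f \<in> borel_measurable borel"
  shows "(\<integral>\<^sup>+z. f z \<partial>lborel) = (\<integral>\<^sup>+x. \<integral>\<^sup>+t. f (x, t) \<partial>lborel \<partial>lborel)"
proof -
  have "f \<in> borel_measurable (lborel \<Otimes>\<^sub>M lborel)" using assms by (simp add: lborel_prod)
  from lborel.nn_integral_fst[OF this] show ?thesis by (simp add: lborel_prod)
qed

lemma
  fixes f :: "'a::euclidean_space \<times> 'b::euclidean_space \<Rightarrow> real"
  assumes "integrable lborel f"
  shows integral_lborel_prod: "(\<integral>z. f z \<partial>lborel) = (\<integral>x. \<integral>t. f (x, t) \<partial>lborel \<partial>lborel)"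
    and integrable_lborel_prod_fst: "integrable lborel (\<lambda>x. \<integral>t. f (x, t) \<partial>lborel)"
    and AE_integrable_lborel_prod: "AE x in lborel. integrable lborel (\<lambda>t. f (x, t))"
proof -
  have f: "integrable (lborel \<Otimes>\<^sub>M lborel) f" using assms by (simp add: lborel_prod)
  show "(\<integral>z. f z \<partial>lborel) = (\<integral>x. \<integral>t. f (x, t) \<partial>lborel \<partial>lborel)"
    using lborel_pair.integral_fst'[OF f] by (simp add: lborel_prod)
  show "integrable lborel (\<lambda>x. \<integral>t. f (x, t) \<partial>lborel)"
    using lborel_pair.integrable_fst'[OF f] by simp
  show "AE x in lborel. integrable lborel (\<lambda>t. f (x, t))"
    using lborel_pair.AE_integrable_fst'[OF f] by simp
qed

text \<open>Projections are measurable for the product sigma-algebra, which is the Borel one on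
  second countable spaces. As raw rules this and the next fact let the measurability prover work
  with \<open>borel\<close> on products.\<close>

lemma borel_measurable_fst_borel [measurable (raw)]:
  fixes f :: "_ \<Rightarrow> 'a::second_countable_topology \<times> 'b::second_countable_topology"
  assumes "f \<in> borel_measurable M"
  shows "(\<lambda>x. fst (f x)) \<in> borel_measurable M"
  using measurable_compose[OF assms[folded borel_prod] measurable_fst] .

lemma borel_measurable_snd_borel [measurable (raw)]:
  fixes f :: "_ \<Rightarrow> 'a::second_countable_topology \<times> 'b::second_countable_topology"
  assumes "f \<in> borel_measurable M"
  shows "(\<lambda>x. snd (f x)) \<in> borel_measurable M"
  using measurable_compose[OF assms[folded borel_prod] measurable_snd] .

lemma borel_measurable_scale_snd [measurable]:
  "(\<lambda>z::'a::euclidean_space \<times> real. (fst z, \<epsilon> * snd z)) \<in> borel_measurable borel"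
  by (intro borel_measurable_continuous_onI continuous_intros)

text \<open>Tonelli reduces this to the substitution t -> \<epsilon> t on each vertical line. Used
  once in each variable of a double integral, it produces the factor \<epsilon>^2.\<close>

lemma nn_integral_lborel_prod_scale_snd:
  fixes f :: "'a::euclidean_space \<times> real \<Rightarrow> ennreal"
  assumes [measurable]: "f \<in> borel_measurable borel" and "\<epsilon> > 0"
  shows "(\<integral>\<^sup>+z. f z \<partial>lborel) = ennreal \<epsilon> * (\<integral>\<^sup>+z. f (fst z, \<epsilon> * snd z) \<partial>lborel)"
proof -
  have "(\<integral>\<^sup>+z. f z \<partial>lborel) = (\<integral>\<^sup>+x. \<integral>\<^sup>+t. f (x, t) \<partial>lborel \<partial>lborel)"
    by (rule nn_integral_lborel_prod) measurable
  also have "\<dots> = (\<integral>\<^sup>+x. ennreal \<epsilon> * (\<integral>\<^sup>+t. f (x, \<epsilon> * t) \<partial>lborel) \<partial>lborel)"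
    using \<open>\<epsilon> > 0\<close> by (subst nn_integral_real_affine[where c = \<epsilon> and t = 0]) auto
  also have "\<dots> = ennreal \<epsilon> * (\<integral>\<^sup>+x. \<integral>\<^sup>+t. f (x, \<epsilon> * t) \<partial>lborel \<partial>lborel)"
    by (rule nn_integral_cmult) measurable
  also have "(\<integral>\<^sup>+x. \<integral>\<^sup>+t. f (x, \<epsilon> * t) \<partial>lborel \<partial>lborel) = (\<integral>\<^sup>+z. f (fst z, \<epsilon> * snd z) \<partial>lborel)"
    using measurable_compose[OF borel_measurable_scale_snd assms(1), of \<epsilon>]
    by (subst nn_integral_lborel_prod) auto
  finally show ?thesis .
qed

text \<open>By the change of variables, the scaling pulls null sets back to null sets. This carries
  almost everywhere statements from the thin domain to the fixed cylinder.\<close>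

lemma AE_lborel_scale_snd:
  fixes P :: "'a::euclidean_space \<times> real \<Rightarrow> bool"
  assumes "AE z in lborel. P z" "\<epsilon> > 0"
  shows "AE z in lborel. P (fst z, \<epsilon> * snd z)"
proof -
  obtain N where N: "{z. \<not> P z} \<subseteq> N" "emeasure lborel N = 0" and [measurable]: "N \<in> sets borel"
    using assms(1) by (auto elim!: AE_E)
  have "ennreal \<epsilon> * (\<integral>\<^sup>+z. indicator N (fst z, \<epsilon> * snd z) \<partial>lborel) = 0"
    using N(2) by (subst nn_integral_lborel_prod_scale_snd[symmetric]) (use assms in auto)
  then have "(\<integral>\<^sup>+z. indicator N (fst z, \<epsilon> * snd z) \<partial>lborel) = 0"
    using assms(2) by (simp add: ennreal_eq_0_iff)
  then have "AE z in lborel. indicator N (fst z :: 'a, \<epsilon> * snd z) = (0::ennreal)"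
    by (subst (asm) nn_integral_0_iff_AE) auto
  then show ?thesis
    by eventually_elim (use N(1) in \<open>auto simp: indicator_eq_0_iff\<close>)
qed

section \<open>Passage from \<open>lebesgue_on A\<close> to Borel functions on the whole
  space\<close>

text \<open>Completion does not change a nonnegative integral, whether or not \<open>f\<close> is
  Borel measurable; this matters for the integrand of \<open>gagliardo_sq\<close>, where
  \<open>u\<close> is only Lebesgue measurable.\<close>

lemma nn_integral_lebesgue_on:
  fixes A :: "'a::euclidean_space set"
  assumes "A \<in> sets borel"
  shows "(\<integral>\<^sup>+x. f x \<partial>lebesgue_on A) = (\<integral>\<^sup>+x. f x * indicator A x \<partial>lborel)"
  using assms by (subst nn_integral_restrict_space) (auto simp: nn_integral_completion)

text \<open>Fubini and the change of variables are applied to Borel functions under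
  \<open>lborel\<close>, so Lebesgue measurable data are first replaced by such a version, cut off
  outside \<open>A\<close>.\<close>

lemma ex_borel_representative:
  fixes A :: "'a::euclidean_space set" and f :: "'a \<Rightarrow> real"
  assumes A: "A \<in> sets borel" and f: "f \<in> borel_measurable (lebesgue_on A)"
  obtains g where "g \<in> borel_measurable borel" "\<And>x. x \<notin> A \<Longrightarrow> g x = 0"
    "AE x in lborel. x \<in> A \<longrightarrow> f x = g x"
proof -
  have "(\<lambda>x. indicator A x *\<^sub>R f x) \<in> borel_measurable lebesgue"
    using f A by (subst (asm) borel_measurable_restrict_space_iff) auto
  then obtain g where g: "g \<in> borel_measurable lborel" "AE x in lborel. indicator A x *\<^sub>R f x = g x"
    by (auto dest: completion_ex_borel_measurable_real)
  show thesis
  proof (rule that)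
    show "(\<lambda>x. indicator A x * g x) \<in> borel_measurable borel" using g(1) A by simp
    show "AE x in lborel. x \<in> A \<longrightarrow> f x = indicator A x * g x"
      using g(2) by eventually_elim auto
  qed auto
qed

text \<open>The extension of \<open>f\<close> by zero agrees with \<open>g\<close> almost
  everywhere. Completeness of the Lebesgue measure makes this extension measurable, and the
  integrals then coincide.\<close>

lemma
  fixes A :: "'a::euclidean_space set" and f g :: "'a \<Rightarrow> real"
  assumes A: "A \<in> sets borel" and g: "g \<in> borel_measurable borel" "\<And>x. x \<notin> A \<Longrightarrow> g x = 0"
    and eq: "AE x in lborel. x \<in> A \<longrightarrow> f x = g x"
  shows measurable_lebesgue_on_representative: "f \<in> borel_measurable (lebesgue_on A)"
    and integrable_lebesgue_on_representative: "integrable (lebesgue_on A) f \<longleftrightarrow> integrable lborel g"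
    and integral_lebesgue_on_representative: "(\<integral>x. f x \<partial>lebesgue_on A) = (\<integral>x. g x \<partial>lborel)"
proof -
  let ?f = "\<lambda>x. indicator A x *\<^sub>R f x"
  have A': "A \<inter> space lebesgue \<in> sets lebesgue" using A by simp
  have eq': "AE x in lebesgue. g x = ?f x"
    by (rule AE_completion, use eq in eventually_elim) (use g(2) in \<open>auto simp: indicator_def\<close>)
  have gl: "g \<in> borel_measurable lebesgue" using g(1) by (simp add: measurable_completion)
  then have f: "?f \<in> borel_measurable lebesgue"
    using eq' by (rule borel_measurable_AE)
  then show "f \<in> borel_measurable (lebesgue_on A)"
    by (subst borel_measurable_restrict_space_iff[OF A'])
  show "integrable (lebesgue_on A) f \<longleftrightarrow> integrable lborel g"
    using integrable_cong_AE[OF gl f eq'] integrable_completion[of g lborel] g(1)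
      integrable_restrict_space[OF A', of f]
    by simp
  show "(\<integral>x. f x \<partial>lebesgue_on A) = (\<integral>x. g x \<partial>lborel)"
    using integral_cong_AE[OF gl f eq'] integral_completion[of g lborel] g(1)
      integral_restrict_space[OF A', of f]
    by simp
qed

lemma L2_on_representative:
  fixes A :: "'a::euclidean_space set" and f g :: "'a \<Rightarrow> real"
  assumes A: "A \<in> sets borel" and g: "g \<in> borel_measurable borel" "\<And>x. x \<notin> A \<Longrightarrow> g x = 0"
    and eq: "AE x in lborel. x \<in> A \<longrightarrow> f x = g x"
  shows "f \<in> L2_on A \<longleftrightarrow> g \<in> square_integrable lborel"
proof -
  have "AE x in lborel. x \<in> A \<longrightarrow> (f x)\<^sup>2 = (g x)\<^sup>2"
    using eq by eventually_elim simp
  then have "integrable (lebesgue_on A) (\<lambda>x. (f x)\<^sup>2) \<longleftrightarrow> integrable lborel (\<lambda>x. (g x)\<^sup>2)"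
    by (intro integrable_lebesgue_on_representative A) (use g in auto)
  with measurable_lebesgue_on_representative[OF A g eq] g(1) show ?thesis
    by (simp add: L2_on_def square_integrable_def)
qed

section \<open>Energy near the diagonal\<close>

text \<open>At distance at most \<open>\<rho>\<close> the Gagliardo kernel is at least the inverse
  of \<open>\<rho> powr (d + 2 * s)\<close>, where d is the dimension.\<close>

lemma near_diagonal_energy_le:
  fixes A :: "'a::euclidean_space set" and u g :: "'a \<Rightarrow> real"
  assumes A[measurable]: "A \<in> sets borel" and g[measurable]: "g \<in> borel_measurable borel"
    and eq: "AE x in lborel. x \<in> A \<longrightarrow> u x = g x" and "\<rho> > 0" "s \<ge> 0"
  shows "(\<integral>\<^sup>+x. \<integral>\<^sup>+y. (if x \<in> A \<and> y \<in> A \<and> norm (x - y) \<le> \<rho> then ennreal ((g x - g y)\<^sup>2) else 0)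
      \<partial>lborel \<partial>lborel) \<le> ennreal (\<rho> powr (real DIM('a) + 2 * s)) * gagliardo_sq s A u"
proof -
  let ?p = "real DIM('a) + 2 * s"
  let ?q = "\<lambda>x y. ennreal ((g x - g y)\<^sup>2 / norm (x - y) powr ?p)"
  have "gagliardo_sq s A u = (\<integral>\<^sup>+x. (\<integral>\<^sup>+y. ?q x y * indicator A y \<partial>lborel) * indicator A x \<partial>lborel)"
    unfolding gagliardo_sq_def nn_integral_lebesgue_on[OF A]
  proof (rule nn_integral_cong_AE, use eq in eventually_elim)
    case (elim x)
    have "(\<integral>\<^sup>+y. ennreal (\<bar>u x - u y\<bar>\<^sup>2 / norm (x - y) powr ?p) * indicator A y \<partial>lborel)
      = (\<integral>\<^sup>+y. ?q x y * indicator A y \<partial>lborel)" if "x \<in> A"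
      using eq by (intro nn_integral_cong_AE, eventually_elim) (use elim that in \<open>auto simp: indicator_def\<close>)
    then show ?case by (auto simp: indicator_def)
  qed
  then have "ennreal (\<rho> powr ?p) * gagliardo_sq s A u
      = (\<integral>\<^sup>+x. \<integral>\<^sup>+y. ennreal (\<rho> powr ?p) * ?q x y * indicator A y * indicator A x \<partial>lborel \<partial>lborel)"
    by (simp add: nn_integral_cmult[symmetric] nn_integral_multc[symmetric] mult.assoc)
  moreover have "(if x \<in> A \<and> y \<in> A \<and> norm (x - y) \<le> \<rho> then ennreal ((g x - g y)\<^sup>2) else 0)
      \<le> ennreal (\<rho> powr ?p) * ?q x y * indicator A y * indicator A x" for x y
  \<comment> \<open>The diagonal is split off: there the quotient is 0 by convention, but the
    squared difference vanishes as well.\<close>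
  proof (cases "x \<in> A \<and> y \<in> A \<and> norm (x - y) \<le> \<rho> \<and> x \<noteq> y")
    case True
    then have "norm (x - y) powr ?p \<le> \<rho> powr ?p" "norm (x - y) powr ?p > 0"
      using assms by (auto intro: powr_mono2)
    then have "(g x - g y)\<^sup>2 \<le> \<rho> powr ?p * ((g x - g y)\<^sup>2 / norm (x - y) powr ?p)"
      by (simp add: field_simps mult_left_mono)
    then show ?thesis using True by (simp add: ennreal_mult'[symmetric])
  qed auto
  ultimately show ?thesis by (auto intro!: nn_integral_mono)
qed

text \<open>The preceding estimate on the thin domain, pulled back to the fixed cylinder. The two
  Jacobians are the source of \<open>1 / \<epsilon>\<^sup>2\<close>, and the exponent contains
  \<open>DIM('a) + 1\<close>, the dimension of the product.\<close>

lemma rescaled_near_diagonal_energy_le: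
  fixes \<omega> :: "'a::euclidean_space set" and u g :: "'a \<times> real \<Rightarrow> real"
  defines "A \<equiv> \<omega> \<times> {0<..<1}"
  assumes \<omega>: "\<omega> \<in> sets borel" and g[measurable]: "g \<in> borel_measurable borel"
    and eq: "AE z in lborel. z \<in> \<omega> \<times> {0<..<\<epsilon>} \<longrightarrow> u z = g z" and "\<rho> > 0" "s \<ge> 0" and \<epsilon>: "\<epsilon> > 0"
  shows "(\<integral>\<^sup>+x. \<integral>\<^sup>+y. (if x \<in> A \<and> y \<in> A \<and> norm ((fst x, \<epsilon> * snd x) - (fst y, \<epsilon> * snd y)) \<le> \<rho>
        then ennreal ((g (fst x, \<epsilon> * snd x) - g (fst y, \<epsilon> * snd y))\<^sup>2) else 0) \<partial>lborel \<partial>lborel)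
    \<le> ennreal (\<rho> powr (real DIM('a) + 1 + 2 * s))
        * (ennreal (1 / \<epsilon>\<^sup>2) * gagliardo_sq s (\<omega> \<times> {0<..<\<epsilon>}) u)"
proof -
  let ?\<Omega> = "\<omega> \<times> {0<..<\<epsilon>}"
  have [measurable]: "?\<Omega> \<in> sets borel" using \<omega> by (intro borel_Times) auto
  let ?F = "\<lambda>x y. if x \<in> ?\<Omega> \<and> y \<in> ?\<Omega> \<and> norm (x - y) \<le> \<rho> then ennreal ((g x - g y)\<^sup>2) else 0"
  define S :: "'a \<times> real \<Rightarrow> 'a \<times> real" where "S z = (fst z, \<epsilon> * snd z)" for z
  have S: "S z \<in> ?\<Omega> \<longleftrightarrow> z \<in> A" for z
    using \<epsilon> by (auto simp: S_def A_def mem_Times_iff zero_less_mult_iff)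
  have [measurable]: "S \<in> borel_measurable borel" unfolding S_def by measurable
  have "(\<integral>\<^sup>+x. \<integral>\<^sup>+y. ?F x y \<partial>lborel \<partial>lborel)
    = ennreal \<epsilon> * (\<integral>\<^sup>+x. (\<integral>\<^sup>+y. ?F (S x) y \<partial>lborel) \<partial>lborel)"
    unfolding S_def by (rule nn_integral_lborel_prod_scale_snd[OF _ \<epsilon>]) measurable
  also have "(\<lambda>x. \<integral>\<^sup>+y. ?F (S x) y \<partial>lborel) = (\<lambda>x. ennreal \<epsilon> * (\<integral>\<^sup>+y. ?F (S x) (S y) \<partial>lborel))"
    unfolding S_def by (rule ext, rule nn_integral_lborel_prod_scale_snd[OF _ \<epsilon>]) measurable
  also have "(\<integral>\<^sup>+x. ennreal \<epsilon> * (\<integral>\<^sup>+y. ?F (S x) (S y) \<partial>lborel) \<partial>lborel)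
    = ennreal \<epsilon> * (\<integral>\<^sup>+x. \<integral>\<^sup>+y. ?F (S x) (S y) \<partial>lborel \<partial>lborel)"
    by (rule nn_integral_cmult) measurable
  finally have "(\<integral>\<^sup>+x. \<integral>\<^sup>+y. ?F (S x) (S y) \<partial>lborel \<partial>lborel)
      = ennreal (1 / \<epsilon>\<^sup>2) * (\<integral>\<^sup>+x. \<integral>\<^sup>+y. ?F x y \<partial>lborel \<partial>lborel)"
    using \<epsilon> by (simp add: mult.assoc[symmetric] ennreal_mult'[symmetric] power2_eq_square)
  also have "\<dots> \<le> ennreal (1 / \<epsilon>\<^sup>2) * (ennreal (\<rho> powr (real DIM('a \<times> real) + 2 * s)) * gagliardo_sq s ?\<Omega> u)"
    by (intro mult_left_mono near_diagonal_energy_le) (use assms in auto)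
  finally show ?thesis
    unfolding S unfolding S_def by (simp add: mult_ac add_ac)
qed


section \<open>Choice of the additive constants\<close>

text \<open>If every slice integral were at least (K + 1) / |A|, integration over \<open>y\<close>
  would give a total of at least K + 1. The value \<open>w y\<close> at the point found serves as
  the constant to subtract.\<close>

lemma ex_point_with_small_energy:
  fixes A :: "'a::euclidean_space set" and w :: "'a \<Rightarrow> real"
  assumes A[measurable]: "A \<in> sets borel" and w[measurable]: "w \<in> borel_measurable borel"
    and pos: "emeasure lborel A > 0" and fin: "emeasure lborel A < \<infinity>"
    and K: "(\<integral>\<^sup>+x. \<integral>\<^sup>+y. (if x \<in> A \<and> y \<in> A then ennreal ((w x - w y)\<^sup>2) else 0) \<partial>lborel \<partial>lborel) \<le> ennreal K"
      "K \<ge> 0"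
  obtains y where "y \<in> A"
    "(\<integral>\<^sup>+x. ennreal ((indicator A x * (w x - w y))\<^sup>2) \<partial>lborel) \<le> ennreal ((K + 1) / measure lborel A)"
proof (rule ccontr)
  assume "\<not> thesis"
  with that have *: "ennreal ((K + 1) / measure lborel A)
      \<le> (\<integral>\<^sup>+x. ennreal ((indicator A x * (w x - w y))\<^sup>2) \<partial>lborel)" if "y \<in> A" for y
    using that by (meson linear)
  have A_eq: "emeasure lborel A = ennreal (measure lborel A)"
    using fin by (intro emeasure_eq_ennreal_measure) auto
  then have m: "measure lborel A > 0" using pos by (cases "measure lborel A > 0") (auto simp: ennreal_neg)
  have "ennreal (K + 1) = ennreal ((K + 1) / measure lborel A) * emeasure lborel A"
    using m K(2) by (simp add: A_eq ennreal_mult'[symmetric])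
  also have "\<dots> = (\<integral>\<^sup>+y. ennreal ((K + 1) / measure lborel A) * indicator A y \<partial>lborel)"
    by (simp add: nn_integral_cmult)
  also have "\<dots> \<le> (\<integral>\<^sup>+y. \<integral>\<^sup>+x. (if y \<in> A \<and> x \<in> A then ennreal ((w y - w x)\<^sup>2) else 0) \<partial>lborel \<partial>lborel)"
  proof (rule nn_integral_mono)
    fix y
    show "ennreal ((K + 1) / measure lborel A) * indicator A y
        \<le> (\<integral>\<^sup>+x. (if y \<in> A \<and> x \<in> A then ennreal ((w y - w x)\<^sup>2) else 0) \<partial>lborel)"
    proof (cases "y \<in> A")
      case True
      have "(\<lambda>x. ennreal ((indicator A x * (w x - w y))\<^sup>2))
          = (\<lambda>x. if y \<in> A \<and> x \<in> A then ennreal ((w y - w x)\<^sup>2) else 0)"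
        using True by (auto simp: fun_eq_iff indicator_def power2_commute)
      with *[OF True] True show ?thesis by simp
    qed simp
  qed
  also have "\<dots> \<le> ennreal K" by (rule K(1))
  finally show False using K(2) by (simp add: ennreal_le_iff)
qed

section \<open>Oscillation in the vertical direction\<close>

text \<open>As \<open>h\<close> has integral zero, any constant \<open>c\<close> may be subtracted
  from \<open>f\<close>; the rest is Young's inequality a b \<le> \<kappa> a^2 + b^2 / \<kappa>.
  Both sides are in \<open>ennreal\<close> because \<open>c\<close> will be a value
  \<open>w y\<close>, over which one integrates next.\<close>

lemma nn_abs_integral_mult_le:
  fixes f h :: "real \<Rightarrow> real"
  assumes [measurable]: "f \<in> borel_measurable borel" "h \<in> borel_measurable borel"
    and fh: "integrable lborel (\<lambda>t. f t * h t)" and h: "integrable lborel h" "(\<integral>t. h t \<partial>lborel) = 0"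
    and I: "\<And>t. t \<notin> I \<Longrightarrow> h t = 0" "I \<in> sets borel" and "\<kappa> > 0"
  shows "ennreal \<bar>\<integral>t. f t * h t \<partial>lborel\<bar>
    \<le> ennreal \<kappa> * (\<integral>\<^sup>+t. indicator I t * ennreal ((f t - c)\<^sup>2) \<partial>lborel)
      + ennreal (1 / \<kappa>) * (\<integral>\<^sup>+t. ennreal ((h t)\<^sup>2) \<partial>lborel)"
proof -
  note [measurable] = I(2)
  have int: "integrable lborel (\<lambda>t. (f t - c) * h t)"
    using fh h(1) by (simp add: left_diff_distrib)
  have "(\<integral>t. f t * h t \<partial>lborel) = (\<integral>t. (f t - c) * h t \<partial>lborel)"
    using fh h by (simp add: left_diff_distrib)
  also have "ennreal \<bar>\<dots>\<bar> \<le> (\<integral>\<^sup>+t. ennreal \<bar>(f t - c) * h t\<bar> \<partial>lborel)"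
    using integral_norm_bound_ennreal[OF int] by simp
  also have "\<dots> \<le> (\<integral>\<^sup>+t. ennreal \<kappa> * (indicator I t * ennreal ((f t - c)\<^sup>2))
      + ennreal (1 / \<kappa>) * ennreal ((h t)\<^sup>2) \<partial>lborel)"
  proof (rule nn_integral_mono)
    fix t
    define a b where "a = \<bar>f t - c\<bar>" and "b = \<bar>h t\<bar>"
    have "0 \<le> \<kappa> * (a - b / \<kappa>)\<^sup>2" using \<open>\<kappa> > 0\<close> by simp
    moreover have "\<kappa> * (a - b / \<kappa>)\<^sup>2 = \<kappa> * a\<^sup>2 + 1 / \<kappa> * b\<^sup>2 - 2 * (a * b)"
      using \<open>\<kappa> > 0\<close> by (simp add: power2_eq_square field_simps)
    moreover have "0 \<le> a * b" by (simp add: a_def b_def)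
    ultimately have "a * b \<le> \<kappa> * a\<^sup>2 + 1 / \<kappa> * b\<^sup>2"
      by linarith
    then have "ennreal \<bar>(f t - c) * h t\<bar> \<le> ennreal \<kappa> * ennreal ((f t - c)\<^sup>2) + ennreal (1 / \<kappa>) * ennreal ((h t)\<^sup>2)"
      using \<open>\<kappa> > 0\<close> by (simp add: a_def b_def abs_mult ennreal_mult'[symmetric] ennreal_plus[symmetric] del: ennreal_plus)
    then show "ennreal \<bar>(f t - c) * h t\<bar> \<le> ennreal \<kappa> * (indicator I t * ennreal ((f t - c)\<^sup>2))
        + ennreal (1 / \<kappa>) * ennreal ((h t)\<^sup>2)"
      using I(1) by (cases "t \<in> I") auto
  qed
  also have "\<dots> = ennreal \<kappa> * (\<integral>\<^sup>+t. indicator I t * ennreal ((f t - c)\<^sup>2) \<partial>lborel)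
      + ennreal (1 / \<kappa>) * (\<integral>\<^sup>+t. ennreal ((h t)\<^sup>2) \<partial>lborel)"
    by (simp add: nn_integral_add nn_integral_cmult)
  finally show ?thesis .
qed

text \<open>On the vertical line over \<open>x\<close> the previous bound holds with
  \<open>c = w y\<close> for every \<open>y\<close> in the cylinder of radius \<open>\<rho>\<close>
  about \<open>x\<close>. Averaging over \<open>y\<close> divides the energy \<open>Q\<close> by the
  volume of that cylinder; integration over \<open>x\<close> finishes the proof.\<close>

lemma vertical_oscillation_le:
  fixes w h :: "'a::euclidean_space \<times> real \<Rightarrow> real"
  assumes [measurable]: "K \<in> sets borel"
    and w: "w \<in> square_integrable lborel" and h: "h \<in> square_integrable lborel"
    and hint: "AE x in lborel. integrable lborel (\<lambda>t. h (x, t)) \<and> (\<integral>t. h (x, t) \<partial>lborel) = 0"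
    and h0: "\<And>z. z \<notin> K \<times> {0<..<1} \<Longrightarrow> h z = 0" and "\<rho> > 0" "\<kappa> > 0"
    and Q: "(\<integral>\<^sup>+z. \<integral>\<^sup>+y. (if z \<in> K \<times> {0<..<1} \<and> y \<in> ball (fst z) \<rho> \<times> {0<..<1}
        then ennreal ((w z - w y)\<^sup>2) else 0) \<partial>lborel \<partial>lborel) \<le> ennreal Q" "Q \<ge> 0"
  shows "\<bar>\<integral>z. w z * h z \<partial>lborel\<bar>
    \<le> \<kappa> * (Q / (unit_ball_vol (real DIM('a)) * \<rho> ^ DIM('a))) + (1 / \<kappa>) * (\<integral>z. (h z)\<^sup>2 \<partial>lborel)"
proof -
  note [measurable] = square_integrable_measurable[OF w] square_integrable_measurable[OF h]
  define V where "V = unit_ball_vol (real DIM('a)) * \<rho> ^ DIM('a)"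
  have V: "V > 0" using \<open>\<rho> > 0\<close> by (simp add: V_def)
  define B where "B x = ball x \<rho> \<times> {0<..<1::real}" for x :: 'a
  have B[measurable]: "B x \<in> sets borel" for x unfolding B_def by (intro borel_Times) auto
  have volB: "emeasure lborel (B x) = ennreal V" for x
  proof -
    have "emeasure lborel (B x) = emeasure (lborel \<Otimes>\<^sub>M lborel) (B x)" by (simp add: lborel_prod)
    also have "\<dots> = emeasure lborel (ball x \<rho>) * emeasure lborel {0<..<1::real}"
      unfolding B_def by (intro lborel.emeasure_pair_measure_Times) auto
    finally show ?thesis using \<open>\<rho> > 0\<close> by (simp add: emeasure_ball V_def)
  qed
  define p q where "p = (fst :: 'a \<times> real \<Rightarrow> 'a)" and "q = (snd :: 'a \<times> real \<Rightarrow> real)"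
  have [measurable]: "p \<in> borel_measurable borel" "q \<in> borel_measurable borel"
    unfolding p_def q_def by (intro borel_measurable_continuous_onI continuous_intros)+
  have B_iff: "y \<in> B x \<longleftrightarrow> dist x (p y) < \<rho> \<and> q y \<in> {0<..<1}" for x y
    by (auto simp: B_def p_def q_def mem_Times_iff)
  define F where "F x t y = (if x \<in> K \<and> t \<in> {0<..<1} \<and> y \<in> B x then ennreal ((w (x, t) - w y)\<^sup>2) else 0)" for x t y
  \<comment> \<open>Joint measurability in all three variables, with membership in the moving set
    \<open>B x\<close> expressed by inequalities. The iterated integrals of \<open>F\<close> and
    their exchange rely on it.\<close>
  have F: "(\<lambda>z. F (fst (fst z)) (snd (fst z)) (snd z)) \<in> borel_measurable ((borel \<Otimes>\<^sub>M borel) \<Otimes>\<^sub>M borel)"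
    unfolding F_def B_iff by measurable
  have [measurable]: "(\<lambda>z. F (f z) (g z) (h z)) \<in> borel_measurable M"
    if [measurable]: "f \<in> borel_measurable M" "g \<in> borel_measurable M" "h \<in> borel_measurable M"
    for f g h and M :: "'c measure"
    using measurable_compose[OF _ F, of "\<lambda>z. ((f z, g z), h z)" M] by simp
  define H where "H x = (\<integral>\<^sup>+t. ennreal ((h (x, t))\<^sup>2) \<partial>lborel)" for x
  have wh: "integrable lborel (\<lambda>z. w z * h z)"
    by (rule square_integrable_integrable_mult[OF w h])
  have fiber: "AE x in lborel. ennreal V * ennreal \<bar>\<integral>t. w (x, t) * h (x, t) \<partial>lborel\<bar>
      \<le> ennreal \<kappa> * (\<integral>\<^sup>+t. \<integral>\<^sup>+y. F x t y \<partial>lborel \<partial>lborel) + ennreal (V / \<kappa>) * H x"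
    using AE_integrable_lborel_prod[OF wh] hint
  proof eventually_elim
    case (elim x)
    let ?a = "ennreal \<bar>\<integral>t. w (x, t) * h (x, t) \<partial>lborel\<bar>"
    show ?case
    proof (cases "x \<in> K")
      case False
      then show ?thesis using h0 by simp
    next
      case True
      \<comment> \<open>\<open>?a\<close> does not depend on \<open>y\<close>, so integrating it
        over \<open>B x\<close> produces the factor \<open>V\<close>.\<close>
      have "ennreal V * ?a = (\<integral>\<^sup>+y. indicator (B x) y * ?a \<partial>lborel)"
        by (simp add: nn_integral_multc volB)
      also have "\<dots> \<le> (\<integral>\<^sup>+y. ennreal \<kappa> * (\<integral>\<^sup>+t. F x t y \<partial>lborel)
          + indicator (B x) y * (ennreal (1 / \<kappa>) * H x) \<partial>lborel)"
      proof (rule nn_integral_mono)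
        fix y
        have "?a \<le> ennreal \<kappa> * (\<integral>\<^sup>+t. F x t y \<partial>lborel) + ennreal (1 / \<kappa>) * H x" if "y \<in> B x"
        proof -
          have "(\<lambda>t. F x t y) = (\<lambda>t. indicator {0<..<1} t * ennreal ((w (x, t) - w y)\<^sup>2))"
            using True that by (auto simp: F_def fun_eq_iff indicator_def)
          then show ?thesis
            using nn_abs_integral_mult_le[of "\<lambda>t. w (x, t)" "\<lambda>t. h (x, t)" "{0<..<1}" \<kappa> "w y"]
              elim h0 \<open>\<kappa> > 0\<close> by (simp add: H_def)
        qed
        then show "indicator (B x) y * ?a \<le> ennreal \<kappa> * (\<integral>\<^sup>+t. F x t y \<partial>lborel)
            + indicator (B x) y * (ennreal (1 / \<kappa>) * H x)"
          by (cases "y \<in> B x") auto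
      qed
      also have "\<dots> = ennreal \<kappa> * (\<integral>\<^sup>+y. \<integral>\<^sup>+t. F x t y \<partial>lborel \<partial>lborel) + ennreal V * (ennreal (1 / \<kappa>) * H x)"
        by (simp add: nn_integral_add nn_integral_cmult nn_integral_multc volB)
      also have "ennreal V * (ennreal (1 / \<kappa>) * H x) = ennreal (V / \<kappa>) * H x"
        using V \<open>\<kappa> > 0\<close> by (simp add: mult.assoc[symmetric] ennreal_mult'[symmetric])
      also have "(\<integral>\<^sup>+y. \<integral>\<^sup>+t. F x t y \<partial>lborel \<partial>lborel) = (\<integral>\<^sup>+t. \<integral>\<^sup>+y. F x t y \<partial>lborel \<partial>lborel)"
        by (rule lborel_pair.Fubini') measurable
      finally show ?thesis .
    qed
  qed
  have "(\<integral>\<^sup>+x. \<integral>\<^sup>+t. \<integral>\<^sup>+y. F x t y \<partial>lborel \<partial>lborel \<partial>lborel)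
      = (\<integral>\<^sup>+z. \<integral>\<^sup>+y. F (fst z) (snd z) y \<partial>lborel \<partial>lborel)"
    by (subst nn_integral_lborel_prod) auto
  also have "\<dots> \<le> ennreal Q"
    using Q(1) by (simp add: F_def B_def mem_Times_iff conj_assoc cong: if_cong)
  finally have FQ: "(\<integral>\<^sup>+x. \<integral>\<^sup>+t. \<integral>\<^sup>+y. F x t y \<partial>lborel \<partial>lborel \<partial>lborel) \<le> ennreal Q" .
  have "ennreal V * ennreal \<bar>\<integral>z. w z * h z \<partial>lborel\<bar>
      \<le> ennreal V * (\<integral>\<^sup>+x. ennreal \<bar>\<integral>t. w (x, t) * h (x, t) \<partial>lborel\<bar> \<partial>lborel)"
    unfolding integral_lborel_prod[OF wh]
    using integral_norm_bound_ennreal[OF integrable_lborel_prod_fst[OF wh]]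
    by (intro mult_left_mono) auto
  also have "\<dots> = (\<integral>\<^sup>+x. ennreal V * ennreal \<bar>\<integral>t. w (x, t) * h (x, t) \<partial>lborel\<bar> \<partial>lborel)"
    using borel_measurable_integrable[OF integrable_lborel_prod_fst[OF wh]]
    by (intro nn_integral_cmult[symmetric]) auto
  also have "\<dots> \<le> (\<integral>\<^sup>+x. ennreal \<kappa> * (\<integral>\<^sup>+t. \<integral>\<^sup>+y. F x t y \<partial>lborel \<partial>lborel) + ennreal (V / \<kappa>) * H x \<partial>lborel)"
    by (rule nn_integral_mono_AE[OF fiber])
  also have "\<dots> = ennreal \<kappa> * (\<integral>\<^sup>+x. \<integral>\<^sup>+t. \<integral>\<^sup>+y. F x t y \<partial>lborel \<partial>lborel \<partial>lborel)
      + ennreal (V / \<kappa>) * (\<integral>\<^sup>+x. H x \<partial>lborel)"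
    unfolding H_def by (simp add: nn_integral_add nn_integral_cmult)
  also have "(\<integral>\<^sup>+x. H x \<partial>lborel) = (\<integral>\<^sup>+z. ennreal ((h z)\<^sup>2) \<partial>lborel)"
    unfolding H_def by (rule nn_integral_lborel_prod[symmetric]) measurable
  also have "\<dots> = ennreal (\<integral>z. (h z)\<^sup>2 \<partial>lborel)"
    by (rule nn_integral_eq_integral) (use square_integrable_integrable_square[OF h] in auto)
  also have "ennreal \<kappa> * (\<integral>\<^sup>+x. \<integral>\<^sup>+t. \<integral>\<^sup>+y. F x t y \<partial>lborel \<partial>lborel \<partial>lborel)
      + ennreal (V / \<kappa>) * ennreal (\<integral>z. (h z)\<^sup>2 \<partial>lborel)
      \<le> ennreal \<kappa> * ennreal Q + ennreal (V / \<kappa>) * ennreal (\<integral>z. (h z)\<^sup>2 \<partial>lborel)"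
    by (intro add_right_mono mult_left_mono FQ) simp
  finally have "ennreal V * ennreal \<bar>\<integral>z. w z * h z \<partial>lborel\<bar>
      \<le> ennreal \<kappa> * ennreal Q + ennreal (V / \<kappa>) * ennreal (\<integral>z. (h z)\<^sup>2 \<partial>lborel)" .
  then have "V * \<bar>\<integral>z. w z * h z \<partial>lborel\<bar> \<le> \<kappa> * Q + (V / \<kappa>) * (\<integral>z. (h z)\<^sup>2 \<partial>lborel)"
    using V \<open>\<kappa> > 0\<close> Q(2)
    by (simp add: ennreal_mult'[symmetric] ennreal_plus[symmetric] del: ennreal_plus)
  then show ?thesis
    using V \<open>\<kappa> > 0\<close> unfolding V_def[symmetric] by (simp add: field_simps)
qed

text \<open>The cylinder radius is taken to be \<open>\<epsilon>\<close>. The energy of the pairs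
  involved is of order \<epsilon>^(n+1) and the cylinder volume of order \<epsilon>^n, with n =
  \<open>DIM('a)\<close>, which leaves a factor \<epsilon>. The constant \<open>c\<close> cancels in
  differences of values of \<open>f\<close>.\<close>

lemma rescaled_oscillation_le:
  fixes \<omega> :: "'a::euclidean_space set" and u g h :: "'a \<times> real \<Rightarrow> real" and \<epsilon> c :: real
  defines "f \<equiv> \<lambda>z. indicator (\<omega> \<times> {0<..<1}) z * (g (fst z, \<epsilon> * snd z) + c)"
  assumes \<omega>: "\<omega> \<in> sets borel" and g: "g \<in> borel_measurable borel"
    and eq: "AE z in lborel. z \<in> \<omega> \<times> {0<..<\<epsilon>} \<longrightarrow> u z = g z" and "s \<ge> 0"
    and C: "ennreal (1 / \<epsilon>\<^sup>2) * gagliardo_sq s (\<omega> \<times> {0<..<\<epsilon>}) u \<le> ennreal C" "C \<ge> 0"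
    and f: "f \<in> square_integrable lborel" and h: "h \<in> square_integrable lborel"
    and hint: "AE x in lborel. integrable lborel (\<lambda>t. h (x, t)) \<and> (\<integral>t. h (x, t) \<partial>lborel) = 0"
    and h0: "\<And>z. z \<notin> K \<times> {0<..<1} \<Longrightarrow> h z = 0"
    and K: "K \<in> sets borel" "\<And>x. x \<in> K \<Longrightarrow> ball x \<epsilon> \<subseteq> \<omega>"
    and \<epsilon>: "0 < \<epsilon>" "2 * \<epsilon> \<le> 1"
  shows "\<bar>\<integral>z. f z * h z \<partial>lborel\<bar>
    \<le> sqrt \<epsilon> * (2 ^ (DIM('a) + 1) * C / unit_ball_vol (real DIM('a)) + (\<integral>z. (h z)\<^sup>2 \<partial>lborel))"
proof -
  let ?A = "\<omega> \<times> {0<..<1::real}" and ?n = "DIM('a)"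
  define Q where "Q = (2 * \<epsilon>) ^ (?n + 1) * C"
  have "(\<integral>\<^sup>+z. \<integral>\<^sup>+y. (if z \<in> K \<times> {0<..<1} \<and> y \<in> ball (fst z) \<epsilon> \<times> {0<..<1}
        then ennreal ((f z - f y)\<^sup>2) else 0) \<partial>lborel \<partial>lborel)
    \<le> (\<integral>\<^sup>+x. \<integral>\<^sup>+y. (if x \<in> ?A \<and> y \<in> ?A \<and> norm ((fst x, \<epsilon> * snd x) - (fst y, \<epsilon> * snd y)) \<le> 2 * \<epsilon>
        then ennreal ((g (fst x, \<epsilon> * snd x) - g (fst y, \<epsilon> * snd y))\<^sup>2) else 0) \<partial>lborel \<partial>lborel)"
  proof (intro nn_integral_mono)
    fix z y :: "'a \<times> real"
    show "(if z \<in> K \<times> {0<..<1} \<and> y \<in> ball (fst z) \<epsilon> \<times> {0<..<1} then ennreal ((f z - f y)\<^sup>2) else 0)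
      \<le> (if z \<in> ?A \<and> y \<in> ?A \<and> norm ((fst z, \<epsilon> * snd z) - (fst y, \<epsilon> * snd y)) \<le> 2 * \<epsilon>
        then ennreal ((g (fst z, \<epsilon> * snd z) - g (fst y, \<epsilon> * snd y))\<^sup>2) else 0)"
    proof (cases "z \<in> K \<times> {0<..<1} \<and> y \<in> ball (fst z) \<epsilon> \<times> {0<..<1}")
      case True
      then have z: "fst z \<in> K" "0 < snd z" "snd z < 1" and y: "dist (fst z) (fst y) < \<epsilon>" "0 < snd y" "snd y < 1"
        by (auto simp: mem_Times_iff)
      have "fst z \<in> ball (fst z) \<epsilon>" using \<epsilon> by simp
      then have mem: "z \<in> ?A" "y \<in> ?A"
        using K(2)[OF z(1)] y z by (auto simp: mem_Times_iff)
      \<comment> \<open>After scaling, the horizontal and the vertical distance are each at most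
        \<open>\<epsilon>\<close>.\<close>
      have "norm ((fst z, \<epsilon> * snd z) - (fst y, \<epsilon> * snd y)) \<le> norm (fst z - fst y) + norm (\<epsilon> * (snd z - snd y))"
        using norm_Pair_le[of "fst z - fst y" "\<epsilon> * (snd z - snd y)"] by (simp add: right_diff_distrib)
      also have "norm (\<epsilon> * (snd z - snd y)) \<le> \<epsilon> * 1"
        unfolding norm_mult using \<epsilon> y z by (intro mult_mono) auto
      also have "norm (fst z - fst y) + \<epsilon> * 1 \<le> 2 * \<epsilon>"
        using y(1) by (simp add: dist_norm)
      finally show ?thesis using mem by (simp add: f_def)
    next
      case False
      show ?thesis by (simp only: if_not_P[OF False] zero_le)
    qed
  qed
  also have "\<dots> \<le> ennreal ((2 * \<epsilon>) powr (real ?n + 1 + 2 * s))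
        * (ennreal (1 / \<epsilon>\<^sup>2) * gagliardo_sq s (\<omega> \<times> {0<..<\<epsilon>}) u)"
    using \<epsilon> by (intro rescaled_near_diagonal_energy_le \<omega> g eq \<open>s \<ge> 0\<close>) auto
  \<comment> \<open>Because \<open>2 * \<epsilon> \<le> 1\<close>, dropping \<open>2 * s\<close>
    from the exponent enlarges the power and makes the bound independent of
    \<open>s\<close>.\<close>
  also have "\<dots> \<le> ennreal ((2 * \<epsilon>) powr real (?n + 1)) * ennreal C"
    using \<epsilon> \<open>s \<ge> 0\<close> by (intro mult_mono ennreal_leI powr_mono' C) auto
  also have "\<dots> = ennreal Q"
    using \<epsilon> by (simp only: Q_def powr_realpow ennreal_mult'[symmetric] zero_less_mult_iff) (simp add: ennreal_mult' C(2) powr_realpow del: of_nat_Suc power_Suc)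
  \<comment> \<open>The choice \<open>\<kappa> = 1 / sqrt \<epsilon>\<close> balances the two terms:
    both become of order \<open>sqrt \<epsilon>\<close>.\<close>
  finally have "\<bar>\<integral>z. f z * h z \<partial>lborel\<bar> \<le> 1 / sqrt \<epsilon> * (Q / (unit_ball_vol (real ?n) * \<epsilon> ^ ?n))
      + 1 / (1 / sqrt \<epsilon>) * (\<integral>z. (h z)\<^sup>2 \<partial>lborel)"
    using \<epsilon> C(2) by (intro vertical_oscillation_le[OF K(1) f h hint h0]) (auto simp: Q_def)
  also have "Q / (unit_ball_vol (real ?n) * \<epsilon> ^ ?n) = (2 ^ (?n + 1) * C / unit_ball_vol (real ?n)) * \<epsilon>"
    using \<epsilon> by (simp add: Q_def power_mult_distrib)
  also have "1 / sqrt \<epsilon> * ((2 ^ (?n + 1) * C / unit_ball_vol (real ?n)) * \<epsilon>)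
      = (\<epsilon> / sqrt \<epsilon>) * (2 ^ (?n + 1) * C / unit_ball_vol (real ?n))"
    by simp
  also have "\<epsilon> / sqrt \<epsilon> = sqrt \<epsilon>" using \<epsilon> by (simp add: real_div_sqrt)
  finally show ?thesis by (simp add: algebra_simps)
qed

section \<open>Functions orthogonal to all test functions with vanishing vertical means\<close>

text \<open>The complement is the union of the open balls about the points outside \<omega>.
  Closedness provides the Borel measurability of these sets.\<close>

lemma closed_inner_parallel_set:
  fixes \<omega> :: "'a::metric_space set"
  shows "closed {x. ball x \<delta> \<subseteq> \<omega>}"
proof -
  have "{x. ball x \<delta> \<subseteq> \<omega>} = - (\<Union>y\<in>-\<omega>. ball y \<delta>)"
    by (auto simp: subset_iff dist_commute)
  then show ?thesis by (simp add: closed_def open_UN)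
qed

text \<open>The difference of \<open>v\<close> and its vertical mean, cut off near the lateral
  boundary, is an admissible test function. It is orthogonal to \<open>v\<close> by hypothesis and
  to the mean by Fubini, hence to itself.\<close>

lemma eq_vertical_mean:
  fixes \<omega> :: "'a::euclidean_space set" and v :: "'a \<times> real \<Rightarrow> real"
  defines "m \<equiv> \<lambda>x. \<integral>t. v (x, t) \<partial>lborel"
  assumes \<omega>: "open \<omega>" and v: "v \<in> square_integrable lborel"
    and v0: "\<And>z. z \<notin> \<omega> \<times> {0<..<1} \<Longrightarrow> v z = 0"
    and orth: "\<And>h \<delta>. \<delta> > 0 \<Longrightarrow> h \<in> square_integrable lborel \<Longrightarrow>
        (\<And>z. z \<notin> {x. ball x \<delta> \<subseteq> \<omega>} \<times> {0<..<1} \<Longrightarrow> h z = 0) \<Longrightarrow>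
        AE x in lborel. integrable lborel (\<lambda>t. h (x, t)) \<and> (\<integral>t. h (x, t) \<partial>lborel) = 0 \<Longrightarrow>
        (\<integral>z. v z * h z \<partial>lborel) = 0"
  shows "m \<in> square_integrable lborel" "AE z in lborel. z \<in> \<omega> \<times> {0<..<1} \<longrightarrow> v z = m (fst z)"
proof -
  note [measurable] = square_integrable_measurable[OF v]
  have m[measurable]: "m \<in> borel_measurable borel" unfolding m_def by measurable
  \<comment> \<open>The indicator has norm one and multiplication by it leaves \<open>v\<close>
    unchanged, so Cauchy-Schwarz bounds the mean by the norm on the vertical line with constant
    1.\<close>
  let ?I = "indicator {0<..<1::real} :: real \<Rightarrow> real"
  have I2: "(?I t)\<^sup>2 = ?I t" for t by (simp add: indicator_def)
  have I: "?I \<in> square_integrable lborel"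
    by (simp add: square_integrable_def I2)
  have vI: "v (x, t) * ?I t = v (x, t)" for x t using v0[of "(x, t)"] by (auto simp: indicator_def)
  have v2: "AE x in lborel. integrable lborel (\<lambda>t. (v (x, t))\<^sup>2)"
    by (rule AE_integrable_lborel_prod[OF square_integrable_integrable_square[OF v]])
  have fiber: "AE x in lborel. (\<lambda>t. v (x, t)) \<in> square_integrable lborel"
    using v2 by eventually_elim (simp add: square_integrable_def)
  have fiber_int: "AE x in lborel. integrable lborel (\<lambda>t. v (x, t))"
    using fiber
  proof eventually_elim
    case (elim x)
    show ?case using square_integrable_integrable_mult[OF elim I] by (simp only: vI)
  qed
  have m_le: "AE x in lborel. (m x)\<^sup>2 \<le> (\<integral>t. (v (x, t))\<^sup>2 \<partial>lborel)"
    using fiber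
  proof eventually_elim
    case (elim x)
    have I1: "(\<integral>t. (?I t)\<^sup>2 \<partial>lborel) = 1" by (simp add: I2)
    have "\<bar>m x\<bar> \<le> sqrt (\<integral>t. (v (x, t))\<^sup>2 \<partial>lborel)"
      using Cauchy_Schwarz_integral[OF elim I] unfolding vI I1 by (simp add: m_def)
    then have "\<bar>m x\<bar>\<^sup>2 \<le> (sqrt (\<integral>t. (v (x, t))\<^sup>2 \<partial>lborel))\<^sup>2" by (rule power_mono) simp
    then show ?case by simp
  qed
  have m2: "integrable lborel (\<lambda>x. (m x)\<^sup>2)"
    by (rule Bochner_Integration.integrable_bound[OF
          integrable_lborel_prod_fst[OF square_integrable_integrable_square[OF v]]])
      (use m_le in \<open>auto elim!: eventually_mono\<close>)
  then show "m \<in> square_integrable lborel" by (simp add: square_integrable_def)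
  \<comment> \<open>The mean as a function on the cylinder; cutting it off outside the unit interval
    keeps it square integrable on the whole space.\<close>
  define M where "M z = m (fst z) * ?I (snd z)" for z
  have [measurable]: "M \<in> borel_measurable borel" unfolding M_def by measurable
  have M: "M \<in> square_integrable lborel"
  proof -
    have "(\<integral>\<^sup>+z. ennreal ((M z)\<^sup>2) \<partial>lborel) = (\<integral>\<^sup>+x. \<integral>\<^sup>+t. ennreal ((m x)\<^sup>2) * indicator {0<..<1::real} t \<partial>lborel \<partial>lborel)"
      by (subst nn_integral_lborel_prod) (auto simp: M_def indicator_def intro!: nn_integral_cong)
    also have "\<dots> = (\<integral>\<^sup>+x. ennreal ((m x)\<^sup>2) \<partial>lborel)"
      by (simp add: nn_integral_cmult)
    also have "\<dots> < \<infinity>"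
      using m2 by (subst nn_integral_eq_integral) auto
    finally show ?thesis by (auto simp: square_integrable_def intro!: integrableI_nonneg)
  qed
  have zero: "AE z in lborel. fst z \<in> {x. ball x \<delta> \<subseteq> \<omega>} \<longrightarrow> v z = M z" if "\<delta> > 0" for \<delta>
  proof -
    let ?K = "{x. ball x \<delta> \<subseteq> \<omega>}"
    have [measurable]: "?K \<in> sets borel" by (rule borel_closed[OF closed_inner_parallel_set])
    define h where "h z = indicator ?K (fst z) * (v z - M z)" for z
    have [measurable]: "h \<in> borel_measurable borel" unfolding h_def by measurable
    have h: "h \<in> square_integrable lborel"
    proof -
      have "(\<lambda>z. v z - M z) \<in> square_integrable lborel" by (rule square_integrable_diff[OF v M])
      then show ?thesis
        by (auto simp: square_integrable_def intro!: Bochner_Integration.integrable_bound[of lborel "\<lambda>z. (v z - M z)\<^sup>2" "\<lambda>z. (h z)\<^sup>2"])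
          (auto simp: h_def indicator_def)
    qed
    have h0: "h z = 0" if "z \<notin> ?K \<times> {0<..<1}" for z
      using that v0[of z] by (auto simp: h_def M_def indicator_def mem_Times_iff)
    have hint: "AE x in lborel. integrable lborel (\<lambda>t. h (x, t)) \<and> (\<integral>t. h (x, t) \<partial>lborel) = 0"
      using fiber_int
    proof eventually_elim
      case (elim x)
      have "(\<integral>t. v (x, t) - M (x, t) \<partial>lborel) = 0"
        using elim by (simp add: M_def m_def)
      then show ?case using elim by (simp add: h_def M_def)
    qed
    have Mh: "(\<integral>z. M z * h z \<partial>lborel) = 0"
    proof -
      have "(\<integral>z. M z * h z \<partial>lborel) = (\<integral>x. \<integral>t. M (x, t) * h (x, t) \<partial>lborel \<partial>lborel)"
        by (rule integral_lborel_prod[OF square_integrable_integrable_mult[OF M h]])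
      also have "(\<lambda>x. \<integral>t. M (x, t) * h (x, t) \<partial>lborel) = (\<lambda>x. m x * (\<integral>t. h (x, t) \<partial>lborel))"
      proof
        fix x
        have Mh_t: "M (x, t) * h (x, t) = m x * h (x, t)" for t
          using h0[of "(x, t)"] by (auto simp: M_def indicator_def)
        show "(\<integral>t. M (x, t) * h (x, t) \<partial>lborel) = m x * (\<integral>t. h (x, t) \<partial>lborel)"
          unfolding Mh_t by (rule integral_mult_right_zero)
      qed
      also have "(\<integral>x. m x * (\<integral>t. h (x, t) \<partial>lborel) \<partial>lborel) = 0"
        by (rule integral_eq_zero_AE, use hint in eventually_elim) simp
      finally show ?thesis .
    qed
    \<comment> \<open>\<open>h\<close> is \<open>v - M\<close> times an indicator, so its square is
      the product of \<open>h\<close> and \<open>v - M\<close>.\<close>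
    have "(\<integral>z. (h z)\<^sup>2 \<partial>lborel) = (\<integral>z. v z * h z - M z * h z \<partial>lborel)"
      by (rule Bochner_Integration.integral_cong) (auto simp: h_def indicator_def power2_eq_square algebra_simps)
    also have "\<dots> = 0"
      using orth[OF that h h0 hint] Mh square_integrable_integrable_mult[OF v h]
        square_integrable_integrable_mult[OF M h] by simp
    finally have "AE z in lborel. (h z)\<^sup>2 = 0"
      using square_integrable_integrable_square[OF h]
      by (subst integral_nonneg_eq_0_iff_AE[symmetric]) auto
    then show ?thesis
      by eventually_elim (auto simp: h_def)
  qed
  \<comment> \<open>Countably many radii suffice to exhaust the open set \<omega>, so the
    exceptional null sets can be united.\<close>
  have "AE z in lborel. \<forall>j::nat. fst z \<in> {x. ball x (1 / real (Suc j)) \<subseteq> \<omega>} \<longrightarrow> v z = M z"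
    unfolding AE_all_countable by (intro allI zero) simp
  then show "AE z in lborel. z \<in> \<omega> \<times> {0<..<1} \<longrightarrow> v z = m (fst z)"
  proof eventually_elim
    case (elim z)
    show ?case
    proof
      assume z: "z \<in> \<omega> \<times> {0<..<1}"
      then obtain e where "e > 0" "ball (fst z) e \<subseteq> \<omega>"
        using \<omega> by (auto simp: open_contains_ball mem_Times_iff)
      moreover obtain j where "1 / real (Suc j) < e"
        using nat_approx_posE[OF \<open>e > 0\<close>] by auto
      ultimately have "ball (fst z) (1 / real (Suc j)) \<subseteq> \<omega>"
        using subset_ball[of "1 / real (Suc j)" e "fst z"] by auto
      with elim z show "v z = m (fst z)" by (auto simp: M_def mem_Times_iff)
    qed
  qed
qed

lemma L2_on_empty: "f \<in> L2_on {}"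
  by (subst L2_on_representative[of "{}" "\<lambda>_. 0"]) (auto simp: square_integrable_def)

lemma integral_lebesgue_on_empty:
  fixes f :: "'a::euclidean_space \<Rightarrow> real"
  shows "(\<integral>x. f x \<partial>lebesgue_on {}) = 0"
  by (subst integral_lebesgue_on_representative[of "{}" "\<lambda>_. 0"]) auto

section \<open>Compactness under the scaled energy bound\<close>

theorem lemma3p5:
  fixes \<omega> :: "(real^'n) set"
    and \<epsilon> s :: "nat \<Rightarrow> real"
    and s0 :: real
    and u :: "nat \<Rightarrow> (real^'n) \<times> real \<Rightarrow> real"
  assumes "bounded_lipschitz_set \<omega>"
    and "\<And>k. \<epsilon> k > 0"
    and "\<epsilon> \<longlonglongrightarrow> 0"
    and "\<And>k. s k \<in> {0<..<1/2}"
    and "s0 \<in> {0..<1/2}"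
    and "s \<longlonglongrightarrow> s0"
    and "\<And>k. u k \<in> frac_sobolev (s k) (thin_domain \<omega> (\<epsilon> k))"
    and "(SUP k. ennreal (1 / (\<epsilon> k)\<^sup>2) * gagliardo_sq (s k) (thin_domain \<omega> (\<epsilon> k)) (u k)) < \<infinity>"
  shows "\<exists>(u0 :: real^'n \<Rightarrow> real) (c :: nat \<Rightarrow> real) (r :: nat \<Rightarrow> nat).
    u0 \<in> L2_on \<omega> \<and> strict_mono r \<and>
    weak_dimred_converges \<omega> (\<epsilon> \<circ> r) (\<lambda>k x. u (r k) x + c (r k)) u0"
proof (cases "\<omega> = {}")
  \<comment> \<open>Over the empty set all integrals vanish. The other case provides a cylinder of
    positive measure, as the choice of the constants requires.\<close>
  case True
  then show ?thesis
    using strict_mono_id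
    by (intro exI[of _ "\<lambda>_. 0"] exI[of _ "\<lambda>_. 0"] exI[of _ id])
      (simp add: weak_dimred_converges_def weakly_converges_L2_def L2_on_empty integral_lebesgue_on_empty)
next
  case False
  note \<epsilon>_pos = assms(2)
  have \<omega>: "open \<omega>" "bounded \<omega>" using assms(1) by (auto simp: bounded_lipschitz_set_def)
  then have \<omega>_borel[measurable]: "\<omega> \<in> sets borel" by simp
  have s: "0 < s k" "s k < 1/2" for k using assms(4)[of k] by auto
  define A where "A = \<omega> \<times> {0<..<1::real}"
  have "open A" unfolding A_def using \<omega> by (intro open_Times) auto
  then have A[measurable]: "A \<in> sets borel" by simp
  have A_pos: "emeasure lborel A > 0"
  proof -
    have "A \<noteq> {}" using False by (auto simp: A_def)
    then obtain x e where "e > 0" "ball x e \<subseteq> A"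
      using \<open>open A\<close> by (meson all_not_in_conv open_contains_ball)
    then have "emeasure lborel (ball x e) \<le> emeasure lborel A"
      by (intro emeasure_mono) auto
    moreover have "0 < emeasure lborel (ball x e)"
      using \<open>e > 0\<close> by (simp add: emeasure_ball)
    ultimately show ?thesis by (rule less_le_trans[rotated])
  qed
  have "bounded A" unfolding A_def using \<omega> by (intro bounded_Times) auto
  then have A_fin: "emeasure lborel A < \<infinity>" by (rule emeasure_bounded_finite)
  obtain C where C: "\<And>k. ennreal (1 / (\<epsilon> k)\<^sup>2) * gagliardo_sq (s k) (\<omega> \<times> {0<..<\<epsilon> k}) (u k) \<le> ennreal C" "C \<ge> 0"
  proof -
    let ?S = "SUP k. ennreal (1 / (\<epsilon> k)\<^sup>2) * gagliardo_sq (s k) (thin_domain \<omega> (\<epsilon> k)) (u k)"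
    obtain C where "?S = ennreal C" "C \<ge> 0" using assms(8) by (cases ?S) auto
    moreover have "ennreal (1 / (\<epsilon> k)\<^sup>2) * gagliardo_sq (s k) (thin_domain \<omega> (\<epsilon> k)) (u k) \<le> ?S" for k
      by (rule SUP_upper) simp
    ultimately show thesis using that[of C] by (simp add: thin_domain_def)
  qed
  have "\<exists>g\<in>borel_measurable borel. AE z in lborel. z \<in> \<omega> \<times> {0<..<\<epsilon> k} \<longrightarrow> u k z = g z" for k
  proof -
    have "\<omega> \<times> {0<..<\<epsilon> k} \<in> sets borel" by (intro borel_Times) auto
    moreover have "u k \<in> borel_measurable (lebesgue_on (\<omega> \<times> {0<..<\<epsilon> k}))"
      using assms(7)[of k] by (simp add: frac_sobolev_def L2_on_def thin_domain_def)
    ultimately obtain g where "g \<in> borel_measurable borel"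
      "AE z in lborel. z \<in> \<omega> \<times> {0<..<\<epsilon> k} \<longrightarrow> u k z = g z"
      by (rule ex_borel_representative)
    then show ?thesis by (intro bexI[where x = g])
  qed
  then have "\<exists>g. \<forall>k. g k \<in> borel_measurable borel \<and> (AE z in lborel. z \<in> \<omega> \<times> {0<..<\<epsilon> k} \<longrightarrow> u k z = g k z)"
    by (intro choice) blast
  then obtain g where g[measurable]: "\<And>k. g k \<in> borel_measurable borel"
    and ug: "\<And>k. AE z in lborel. z \<in> \<omega> \<times> {0<..<\<epsilon> k} \<longrightarrow> u k z = g k z" by blast
  define S where "S k z = (fst z, \<epsilon> k * snd z)" for k and z :: "(real^'n) \<times> real"
  have S[measurable]: "S k \<in> borel_measurable borel" for k unfolding S_def by measurable
  \<comment> \<open>A convergent sequence \<open>\<epsilon>\<close> is bounded, so all rescaled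
    cylinders lie in one ball. The bound \<open>D \<ge> 1\<close> makes \<open>D powr p\<close>
    increasing in \<open>p\<close>.\<close>
  obtain D where D: "D \<ge> 1" "\<And>k x y. x \<in> A \<Longrightarrow> y \<in> A \<Longrightarrow> norm (S k x - S k y) \<le> D"
  proof -
    obtain E where E: "\<And>k. \<bar>\<epsilon> k\<bar> \<le> E"
      using convergent_imp_Bseq[OF convergentI[OF assms(3)]] by (auto simp: Bseq_def)
    obtain b where b: "\<And>x. x \<in> \<omega> \<Longrightarrow> norm x \<le> b" using \<omega>(2) by (auto simp: bounded_iff)
    have "norm (S k x - S k y) \<le> max 1 ((b + E) + (b + E))" if "x \<in> A" "y \<in> A" for k x y
    proof -
      have "norm (S k z) \<le> b + E" if "z \<in> A" for z
      proof -
        have "norm (S k z) \<le> norm (fst z) + norm (\<epsilon> k * snd z)" unfolding S_def by (rule norm_Pair_le)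
        moreover have "norm (fst z) \<le> b" using b that by (auto simp: A_def mem_Times_iff)
        moreover have "norm (\<epsilon> k * snd z) \<le> E * 1"
          unfolding norm_mult using E[of k] that
          by (intro mult_mono) (auto simp: A_def mem_Times_iff intro: order_trans[OF abs_ge_zero])
        ultimately show ?thesis by simp
      qed
      from norm_triangle_ineq4[of "S k x" "S k y"] add_mono[OF this[OF that(1)] this[OF that(2)]]
      have "norm (S k x - S k y) \<le> (b + E) + (b + E)" by (rule order_trans)
      then show ?thesis by (rule max.coboundedI2)
    qed
    then show thesis by (intro that[of "max 1 ((b + E) + (b + E))"]) auto
  qed
  \<comment> \<open>The exponent \<open>CARD('n) + 1 + 2 * s k\<close> is below
    \<open>CARD('n) + 2\<close> since \<open>s k < 1/2\<close>; this makes the bound uniform in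
    \<open>k\<close>.\<close>
  define K where "K = D powr (real CARD('n) + 2) * C"
  have K: "K \<ge> 0" using C(2) by (simp add: K_def)
  have energy: "(\<integral>\<^sup>+x. \<integral>\<^sup>+y. (if x \<in> A \<and> y \<in> A then ennreal ((g k (S k x) - g k (S k y))\<^sup>2) else 0) \<partial>lborel \<partial>lborel)
      \<le> ennreal K" for k
  proof -
    have "(\<integral>\<^sup>+x. \<integral>\<^sup>+y. (if x \<in> A \<and> y \<in> A then ennreal ((g k (S k x) - g k (S k y))\<^sup>2) else 0) \<partial>lborel \<partial>lborel)
      = (\<integral>\<^sup>+x. \<integral>\<^sup>+y. (if x \<in> A \<and> y \<in> A \<and> norm (S k x - S k y) \<le> D
          then ennreal ((g k (S k x) - g k (S k y))\<^sup>2) else 0) \<partial>lborel \<partial>lborel)"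
      by (intro nn_integral_cong) (auto simp: D(2))
    also have "\<dots> \<le> ennreal (D powr (real DIM(real^'n) + 1 + 2 * s k))
        * (ennreal (1 / (\<epsilon> k)\<^sup>2) * gagliardo_sq (s k) (\<omega> \<times> {0<..<\<epsilon> k}) (u k))"
      unfolding A_def S_def
      by (rule rescaled_near_diagonal_energy_le[OF \<omega>_borel g ug]) (use D s[of k] \<epsilon>_pos in auto)
    also have "\<dots> \<le> ennreal (D powr (real CARD('n) + 2)) * ennreal C"
      using D(1) s[of k] by (intro mult_mono ennreal_leI powr_mono C) auto
    also have "\<dots> = ennreal K" using C(2) by (simp add: K_def ennreal_mult')
    finally show ?thesis .
  qed
  have ex_c: "\<exists>c. (\<integral>\<^sup>+x. ennreal ((indicator A x * (g k (S k x) + c))\<^sup>2) \<partial>lborel) \<le> ennreal ((K + 1) / measure lborel A)" for k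
  proof -
    obtain y where "(\<integral>\<^sup>+x. ennreal ((indicator A x * (g k (S k x) - g k (S k y)))\<^sup>2) \<partial>lborel)
        \<le> ennreal ((K + 1) / measure lborel A)"
      by (rule ex_point_with_small_energy[OF A _ A_pos A_fin energy[of k] K]) auto
    then show ?thesis by (intro exI[of _ "- g k (S k y)"]) simp
  qed
  define c where "c k = (SOME c. (\<integral>\<^sup>+x. ennreal ((indicator A x * (g k (S k x) + c))\<^sup>2) \<partial>lborel)
      \<le> ennreal ((K + 1) / measure lborel A))" for k
  have c: "(\<integral>\<^sup>+x. ennreal ((indicator A x * (g k (S k x) + c k))\<^sup>2) \<partial>lborel)
      \<le> ennreal ((K + 1) / measure lborel A)" for k
    unfolding c_def by (rule someI_ex[OF ex_c])
  \<comment> \<open>Extension by zero places the whole sequence in the square integrable functions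
    for \<open>lborel\<close>.\<close>
  define f where "f k x = indicator A x * (g k (S k x) + c k)" for k x
  have f_meas[measurable]: "f k \<in> borel_measurable borel" for k unfolding f_def by measurable
  have f: "f k \<in> square_integrable lborel" for k
    using le_less_trans[OF c[of k] ennreal_less_top]
    by (auto simp: square_integrable_def f_def[symmetric] intro!: integrableI_nonneg)
  have f_bound: "(\<integral>x. (f k x)\<^sup>2 \<partial>lborel) \<le> (K + 1) / measure lborel A" for k
  proof -
    have "ennreal (\<integral>x. (f k x)\<^sup>2 \<partial>lborel) \<le> ennreal ((K + 1) / measure lborel A)"
      using c[of k] square_integrable_integrable_square[OF f[of k]]
      by (subst nn_integral_eq_integral[symmetric]) (auto simp: f_def)
    then show ?thesis using K by (subst (asm) ennreal_le_iff) auto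
  qed
  obtain r v where r: "strict_mono r" and v: "v \<in> square_integrable lborel"
    and weak: "\<forall>\<phi>\<in>square_integrable lborel.
      (\<lambda>k. \<integral>x. f (r k) x * \<phi> x \<partial>lborel) \<longlonglongrightarrow> (\<integral>x. v x * \<phi> x \<partial>lborel)"
    by (rule weakly_convergent_subsequence[of f, OF f f_bound])
  note [measurable] = square_integrable_measurable[OF v]
  \<comment> \<open>Cutting off the weak limit makes it vanish at every point outside
    \<open>A\<close>, as \<open>eq_vertical_mean\<close> demands; test functions supported in
    \<open>A\<close> do not see the change.\<close>
  define w where "w x = indicator A x * v x" for x
  have [measurable]: "w \<in> borel_measurable borel" unfolding w_def by measurable
  have w: "w \<in> square_integrable lborel"
    using square_integrable_integrable_square[OF v]
    by (auto simp: square_integrable_def intro!: Bochner_Integration.integrable_bound[of lborel "\<lambda>z. (v z)\<^sup>2" "\<lambda>z. (w z)\<^sup>2"])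
      (auto simp: w_def indicator_def)
  have w0: "w z = 0" if "z \<notin> \<omega> \<times> {0<..<1}" for z using that by (simp add: w_def A_def)
  have weak_w: "(\<lambda>k. \<integral>x. f (r k) x * \<phi> x \<partial>lborel) \<longlonglongrightarrow> (\<integral>x. w x * \<phi> x \<partial>lborel)"
    if "\<phi> \<in> square_integrable lborel" "\<And>z. z \<notin> A \<Longrightarrow> \<phi> z = 0" for \<phi>
  proof -
    have "(\<lambda>x. w x * \<phi> x) = (\<lambda>x. v x * \<phi> x)" using that(2) by (auto simp: w_def indicator_def fun_eq_iff)
    then show ?thesis using bspec[OF weak that(1)] by simp
  qed
  have \<epsilon>r: "(\<lambda>k. \<epsilon> (r k)) \<longlonglongrightarrow> 0"
    using LIMSEQ_subseq_LIMSEQ[OF assms(3) r] by (simp add: comp_def)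
  define m where "m x = (\<integral>t. w (x, t) \<partial>lborel)" for x
  have m: "m \<in> square_integrable lborel" and wm: "AE z in lborel. z \<in> \<omega> \<times> {0<..<1} \<longrightarrow> w z = m (fst z)"
  proof -
    have orth: "(\<integral>z. w z * h z \<partial>lborel) = 0"
      if "\<delta> > 0" and h: "h \<in> square_integrable lborel"
        and h0: "\<And>z. z \<notin> {x. ball x \<delta> \<subseteq> \<omega>} \<times> {0<..<1} \<Longrightarrow> h z = 0"
        and hint: "AE x in lborel. integrable lborel (\<lambda>t. h (x, t)) \<and> (\<integral>t. h (x, t) \<partial>lborel) = 0" for h \<delta>
    proof -
      define B where "B = 2 ^ (CARD('n) + 1) * C / unit_ball_vol (real CARD('n)) + (\<integral>z. (h z)\<^sup>2 \<partial>lborel)"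
      have "h z = 0" if "z \<notin> A" for z
      proof (rule h0)
        have "fst z \<in> \<omega>" if "ball (fst z) \<delta> \<subseteq> \<omega>" using that \<open>\<delta> > 0\<close> by auto
        then show "z \<notin> {x. ball x \<delta> \<subseteq> \<omega>} \<times> {0<..<1}" using that by (auto simp: A_def mem_Times_iff)
      qed
      then have "(\<lambda>k. \<integral>z. f (r k) z * h z \<partial>lborel) \<longlonglongrightarrow> (\<integral>z. w z * h z \<partial>lborel)"
        by (rule weak_w[OF h])
      moreover have "(\<lambda>k. \<integral>z. f (r k) z * h z \<partial>lborel) \<longlonglongrightarrow> 0"
      proof (rule Lim_null_comparison)
        \<comment> \<open>From such an index on, balls of radius \<open>\<epsilon> (r k)\<close>
          about points of the inner parallel set stay in \<omega>, and
          \<open>2 * \<epsilon> (r k) \<le> 1\<close>.\<close>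
        have "eventually (\<lambda>k. \<epsilon> (r k) < min \<delta> (1/2)) sequentially"
          using \<open>\<delta> > 0\<close> by (intro order_tendstoD(2)[OF \<epsilon>r]) auto
        then show "eventually (\<lambda>k. norm (\<integral>z. f (r k) z * h z \<partial>lborel) \<le> sqrt (\<epsilon> (r k)) * B) sequentially"
        proof eventually_elim
          case (elim k)
          have f_eq: "f (r k) = (\<lambda>z. indicator (\<omega> \<times> {0<..<1}) z * (g (r k) (fst z, \<epsilon> (r k) * snd z) + c (r k)))"
            by (simp add: f_def A_def S_def fun_eq_iff)
          have "ball x (\<epsilon> (r k)) \<subseteq> \<omega>" if "x \<in> {x. ball x \<delta> \<subseteq> \<omega>}" for x
            using that elim subset_ball[of "\<epsilon> (r k)" \<delta> x] by auto
          then have "\<bar>\<integral>z. f (r k) z * h z \<partial>lborel\<bar> \<le> sqrt (\<epsilon> (r k))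
              * (2 ^ (DIM(real^'n) + 1) * C / unit_ball_vol (real DIM(real^'n)) + (\<integral>z. (h z)\<^sup>2 \<partial>lborel))"
            unfolding f_eq using elim \<epsilon>_pos s(1)[of "r k"] f[of "r k", unfolded f_eq]
            by (intro rescaled_oscillation_le[OF \<omega>_borel g ug _ C _ h hint h0])
              (auto intro: borel_closed closed_inner_parallel_set)
          then show ?case by (simp add: B_def)
        qed
        show "(\<lambda>k. sqrt (\<epsilon> (r k)) * B) \<longlonglongrightarrow> 0"
          using tendsto_mult[OF tendsto_real_sqrt[OF \<epsilon>r] tendsto_const[of B]] by simp
      qed
      ultimately show ?thesis by (rule LIMSEQ_unique)
    qed
    show "m \<in> square_integrable lborel" "AE z in lborel. z \<in> \<omega> \<times> {0<..<1} \<longrightarrow> w z = m (fst z)"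
      unfolding m_def by (rule eq_vertical_mean[OF \<omega>(1) w w0 orth]; assumption)+
  qed
  have m0: "m x = 0" if "x \<notin> \<omega>" for x using that by (simp add: m_def w_def A_def)
  have "m \<in> L2_on \<omega>"
    using m by (subst L2_on_representative[OF \<omega>_borel _ m0]) (auto dest: square_integrable_measurable)
  moreover have "weakly_converges_L2 A (\<lambda>k (x', xd). u (r k) (x', \<epsilon> (r k) * xd) + c (r k)) (\<lambda>(x', xd). m x')"
    unfolding weakly_converges_L2_def
  proof (intro conjI allI ballI)
    \<comment> \<open>The almost everywhere equality of \<open>u k\<close> and \<open>g k\<close>
      survives the vertical scaling.\<close>
    have f_rep: "AE z in lborel. z \<in> A \<longrightarrow> (case z of (x', xd) \<Rightarrow> u k (x', \<epsilon> k * xd) + c k) = f k z" for k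
      using AE_lborel_scale_snd[OF ug[of k] \<epsilon>_pos[of k]]
    proof eventually_elim
      case (elim z)
      then show ?case
        using \<epsilon>_pos[of k] by (auto simp: f_def S_def A_def mem_Times_iff split: prod.split)
    qed
    have w_rep: "AE z in lborel. z \<in> A \<longrightarrow> (case z of (x', xd) \<Rightarrow> m x') = w z"
      using wm by eventually_elim (auto simp: A_def)
    have f0: "f k z = 0" if "z \<notin> A" for k z using that by (simp add: f_def)
    have w0': "w z = 0" if "z \<notin> A" for z using that by (simp add: w_def)
    show "(\<lambda>(x', xd). u (r k) (x', \<epsilon> (r k) * xd) + c (r k)) \<in> L2_on A" for k
      using f by (subst L2_on_representative[OF A f_meas f0 f_rep])
    show "(\<lambda>(x', xd). m x') \<in> L2_on A"
      using w by (subst L2_on_representative[OF A _ w0' w_rep]) auto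
    fix \<phi> assume \<phi>: "\<phi> \<in> L2_on A"
    \<comment> \<open>A Borel version of the test function, zero outside \<open>A\<close>, brings
      the limit back to the one already known under \<open>lborel\<close>.\<close>
    then obtain \<psi> where \<psi>[measurable]: "\<psi> \<in> borel_measurable borel" and \<psi>0: "\<And>z. z \<notin> A \<Longrightarrow> \<psi> z = 0"
      and \<phi>\<psi>: "AE z in lborel. z \<in> A \<longrightarrow> \<phi> z = \<psi> z"
      using ex_borel_representative[OF A, of \<phi>] by (auto simp: L2_on_def)
    have "\<psi> \<in> square_integrable lborel"
      using \<phi> by (subst (asm) L2_on_representative[OF A \<psi> \<psi>0 \<phi>\<psi>])
    note lim = weak_w[OF this \<psi>0]
    have "(\<integral>z. (case z of (x', xd) \<Rightarrow> u (r k) (x', \<epsilon> (r k) * xd) + c (r k)) * \<phi> z \<partial>lebesgue_on A)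
        = (\<integral>z. f (r k) z * \<psi> z \<partial>lborel)" for k
    proof (rule integral_lebesgue_on_representative[OF A])
      show "AE z in lborel. z \<in> A \<longrightarrow>
          (case z of (x', xd) \<Rightarrow> u (r k) (x', \<epsilon> (r k) * xd) + c (r k)) * \<phi> z = f (r k) z * \<psi> z"
        using f_rep[of "r k"] \<phi>\<psi> by eventually_elim simp
    qed (auto simp: \<psi>0)
    moreover have "(\<integral>z. (case z of (x', xd) \<Rightarrow> m x') * \<phi> z \<partial>lebesgue_on A) = (\<integral>z. w z * \<psi> z \<partial>lborel)"
    proof (rule integral_lebesgue_on_representative[OF A])
      show "AE z in lborel. z \<in> A \<longrightarrow> (case z of (x', xd) \<Rightarrow> m x') * \<phi> z = w z * \<psi> z"
        using w_rep \<phi>\<psi> by eventually_elim simp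
    qed (auto simp: \<psi>0)
    ultimately show "(\<lambda>k. \<integral>z. (case z of (x', xd) \<Rightarrow> u (r k) (x', \<epsilon> (r k) * xd) + c (r k)) * \<phi> z \<partial>lebesgue_on A)
        \<longlonglongrightarrow> (\<integral>z. (case z of (x', xd) \<Rightarrow> m x') * \<phi> z \<partial>lebesgue_on A)"
      using lim by simp
  qed
  ultimately show ?thesis
    using r unfolding weak_dimred_converges_def A_def comp_def by blast
qed

end
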